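(* Let $G:[0,\infty)\times S^{n-1}\to[0,\infty)$ be such that $G_t=\partial G/\partial t$ exists on $(0,\infty)\times S^{n-1}$ and the integral defining $\widetilde{C}_G(L,E)$ exists (as a finite number) for all $L\in\mathcal{K}_o^n$ and all Borel sets $E\subset S^{n-1}$. Let $K\in\mathcal{K}_o^n$. The following statements hold. (i) $\widetilde{C}_G(K,\cdot)$ is a finite signed measure on the Borel sets of $S^{n-1}$. (ii) Suppose that $t^{1-n}G_t(t,u)$ is continuous on $[0,\infty)\times S^{n-1}$, where the value of $t^{1-n}G_t(t,u)$ for each $u\in S^{n-1}$ at $t=0$ is taken to be the value of the limit as $t\to0+$. Then $\widetilde{C}_G(K,\cdot)$ is absolutely continuous with respect to the surface area measure $S(K,\cdot)$. (iii) Suppose that $tG_t(t,u)$ is continuous on $[0,\infty)\times S^{n-1}$, where $tG_t(t,u)=0$ at $t=0$ for $u\in S^{n-1}$. If $K_i\in\mathcal{K}_o^n$ and $K_i\to K$ as $i\to\infty$, then $\widetilde{C}_G(K_i,\cdot)\to\widetilde{C}_G(K,\cdot)$ weakly as $i\to\infty$.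
   Context: Let $n\ge2$, let $o$ be the origin of $\mathbb{R}^n$, $S^{n-1}$ the unit sphere, $\mathcal{H}^{n-1}$ the $(n-1)$-dimensional Hausdorff measure, and $du=d\mathcal{H}^{n-1}(u)$ on $S^{n-1}$. $\mathcal{K}_o^n$ is the class of compact convex subsets of $\mathbb{R}^n$ containing $o$ (not necessarily in the interior). $h_K(u)=\max\{\langle u,x\rangle:x\in K\}$ is the support function, and convergence of sets is with respect to the Hausdorff metric $\delta(K,L)=\sup_{u\in S^{n-1}}|h_K(u)-h_L(u)|$. For $K\in\mathcal{K}_o^n$ and $z\in K$, the normal cone is $N(K,z)=\{y\in\mathbb{R}^n:\langle y,x-z\rangle\le0\text{ for }x\in K\}$. The radial function is $\rho_K(u)=\max\{\lambda\ge0:\lambda u\in K\}$, and the radial map is $r_K:S^{n-1}\to\partial K$, $r_K(u)=\rho_K(u)u$. For $E\subset S^{n-1}$ let $\boldsymbol{\nu}_K^{-1}(E)=\{x\in\partial K:N(K,x)\cap E\neq\emptyset\}$ and $\boldsymbol{\alpha}_K^*(E)=r_K^{-1}(\boldsymbol{\nu}_K^{-1}(E))$. The surface area measure is $S(K,E)=\mathcal{H}^{n-1}(\boldsymbol{\nu}_K^{-1}(E))$ for Borel sets $E\subset S^{n-1}$. Define, for Borel sets $E\subset S^{n-1}$, $$\widetilde{C}_G(K,E)=\frac1n\int_{\boldsymbol{\alpha}_K^*(E\setminus N(K,o))}\rho_K(u)\,G_t(\rho_K(u),u)\,du$$ (note that $\rho_K>0$ on the domain of integration; the integral is $0$ if $\boldsymbol{\alpha}_K^*(E\setminus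 N(K,o))=\emptyset$). Weak convergence of finite signed Borel measures on $S^{n-1}$ means convergence of integrals of every continuous function on $S^{n-1}$. *)

theory Defs
  imports "HOL-Analysis.Analysis"
begin

section \<open>Hausdorff measure\<close>

text \<open>Coverings by arbitrary bounded sets of diameter at most \<open>\<delta>\<close>. The normalisation makes the
  \<open>s\<close>-dimensional Hausdorff measure on an \<open>s\<close>-dimensional Euclidean space equal to Lebesgue measure.
  The empty set is given weight 0 explicitly because \<open>0 ^ 0 = 1\<close>.\<close>

definition hausdorff_premeasure :: "nat \<Rightarrow> real \<Rightarrow> 'a::metric_space set \<Rightarrow> ennreal" where
  "hausdorff_premeasure s \<delta> A =
     (INF C \<in> {C :: nat \<Rightarrow> 'a set. A \<subseteq> (\<Union>i. C i) \<and> (\<forall>i. bounded (C i) \<and> diameter (C i) \<le> \<delta>)}.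
        \<Sum>i. if C i = {} then 0
            else ennreal (unit_ball_vol (real s) * (diameter (C i) / 2) ^ s))"

definition hausdorff_outer_measure :: "nat \<Rightarrow> 'a::metric_space set \<Rightarrow> ennreal" where
  "hausdorff_outer_measure s A = (SUP \<delta> \<in> {0<..}. hausdorff_premeasure s \<delta> A)"

text \<open>The measure lives on all Caratheodory-measurable sets, not only on the Borel sets: the preimages
  under normal and radial maps used below need not be Borel.\<close>

definition hausdorff_measure :: "nat \<Rightarrow> 'a::metric_space measure" where
  "hausdorff_measure s =
     measure_of UNIV (lambda_system UNIV UNIV (hausdorff_outer_measure s)) (hausdorff_outer_measure s)"

lemma hausdorff_premeasure_empty:
  assumes "0 < \<delta>"
  shows "hausdorff_premeasure s \<delta> {} = 0"
proof -
  have "hausdorff_premeasure s \<delta> ({}::'a set) \<le> 0"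
    unfolding hausdorff_premeasure_def
    by (rule INF_lower2[where i = "\<lambda>_. {}"]) (use assms in auto)
  then show ?thesis by simp
qed

lemma hausdorff_premeasure_mono:
  "A \<subseteq> B \<Longrightarrow> hausdorff_premeasure s \<delta> A \<le> hausdorff_premeasure s \<delta> B"
  unfolding hausdorff_premeasure_def by (rule INF_superset_mono) auto

lemma hausdorff_premeasure_countably_subadditive:
  fixes A :: "nat \<Rightarrow> 'a::metric_space set"
  shows "hausdorff_premeasure s \<delta> (\<Union>i. A i) \<le> (\<Sum>i. hausdorff_premeasure s \<delta> (A i))"
proof (rule ennreal_le_epsilon)
  fix e :: real
  assume fin: "(\<Sum>i. hausdorff_premeasure s \<delta> (A i)) < top" and e: "0 < e"
  define w :: "'a set \<Rightarrow> ennreal" where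
    "w C = (if C = {} then 0 else ennreal (unit_ball_vol (real s) * (diameter C / 2) ^ s))" for C
  have "\<exists>C. A i \<subseteq> (\<Union>j. C j) \<and> (\<forall>j. bounded (C j) \<and> diameter (C j) \<le> \<delta>) \<and>
        (\<Sum>j. w (C j)) \<le> hausdorff_premeasure s \<delta> (A i) + ennreal (e * (1/2) ^ Suc i)" for i
  proof -
    have "hausdorff_premeasure s \<delta> (A i) < top"
      using fin by (metis ennreal_suminf_lessD)
    then have "hausdorff_premeasure s \<delta> (A i)
        < hausdorff_premeasure s \<delta> (A i) + ennreal (e * (1/2) ^ Suc i)"
      using e ennreal_add_left_cancel_less[of "hausdorff_premeasure s \<delta> (A i)" 0] by auto
    then show ?thesis
      unfolding hausdorff_premeasure_def INF_less_iff w_def by (blast intro: less_imp_le)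
  qed
  then obtain C where C: "\<And>i. A i \<subseteq> (\<Union>j. C i j)"
      "\<And>i j. bounded (C i j)" "\<And>i j. diameter (C i j) \<le> \<delta>"
      "\<And>i. (\<Sum>j. w (C i j)) \<le> hausdorff_premeasure s \<delta> (A i) + ennreal (e * (1/2) ^ Suc i)"
    by metis
  define D where "D k = case_prod C (prod_decode k)" for k
  have sub: "(\<Union>i. A i) \<subseteq> (\<Union>k. D k)"
  proof
    fix x assume "x \<in> (\<Union>i. A i)"
    then obtain i j where "x \<in> C i j" using C(1) by blast
    then have "x \<in> D (prod_encode (i, j))" by (simp add: D_def)
    then show "x \<in> (\<Union>k. D k)" by blast
  qed
  have "hausdorff_premeasure s \<delta> (\<Union>i. A i) \<le> (\<Sum>k. w (D k))"
    unfolding hausdorff_premeasure_def w_def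
    by (rule INF_lower) (use sub C(2,3) in \<open>auto simp: D_def split: prod.split\<close>)
  also have "\<dots> = (\<Sum>k. (\<lambda>(i, j). w (C i j)) (prod_decode k))"
    by (simp add: D_def case_prod_unfold)
  also have "\<dots> = (\<Sum>i. \<Sum>j. w (C i j))"
    by (subst suminf_ennreal_2dimen[of "\<lambda>i. \<Sum>j. w (C i j)" "\<lambda>(i, j). w (C i j)"])
       (auto simp: comp_def)
  also have "\<dots> \<le> (\<Sum>i. hausdorff_premeasure s \<delta> (A i) + ennreal (e * (1/2) ^ Suc i))"
    by (intro suminf_le C(4)) auto
  also have "\<dots> = (\<Sum>i. hausdorff_premeasure s \<delta> (A i)) + (\<Sum>i. ennreal (e * (1/2) ^ Suc i))"
    by (intro suminf_add[symmetric]) auto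
  also have "(\<Sum>i. ennreal (e * (1/2) ^ Suc i)) = ennreal e"
    using e sums_mult[OF power_half_series, of e] by (intro suminf_ennreal_eq) auto
  finally show "hausdorff_premeasure s \<delta> (\<Union>i. A i) \<le>
    (\<Sum>i. hausdorff_premeasure s \<delta> (A i)) + ennreal e" .
qed

lemma outer_measure_space_hausdorff:
  "outer_measure_space UNIV (hausdorff_outer_measure s :: 'a::metric_space set \<Rightarrow> ennreal)"
  unfolding outer_measure_space_def
proof (intro conjI)
  show "positive UNIV (hausdorff_outer_measure s :: 'a set \<Rightarrow> ennreal)"
    by (auto simp: positive_def hausdorff_outer_measure_def hausdorff_premeasure_empty
        intro!: antisym SUP_least)
  show "increasing UNIV (hausdorff_outer_measure s :: 'a set \<Rightarrow> ennreal)"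
    unfolding increasing_def hausdorff_outer_measure_def
    by (auto intro!: SUP_mono hausdorff_premeasure_mono)
  show "countably_subadditive UNIV (hausdorff_outer_measure s :: 'a set \<Rightarrow> ennreal)"
  proof -
    have "hausdorff_outer_measure s (\<Union>i. A i) \<le> (\<Sum>i. hausdorff_outer_measure s (A i))"
      for A :: "nat \<Rightarrow> 'a set"
    proof -
      have "hausdorff_premeasure s \<delta> (\<Union>i. A i) \<le> (\<Sum>i. hausdorff_outer_measure s (A i))"
        if "0 < \<delta>" for \<delta>
      proof -
        have "(\<Sum>i. hausdorff_premeasure s \<delta> (A i)) \<le> (\<Sum>i. hausdorff_outer_measure s (A i))"
          unfolding hausdorff_outer_measure_def
          using that by (intro suminf_le SUP_upper) auto
        with hausdorff_premeasure_countably_subadditive show ?thesis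
          by (rule order_trans)
      qed
      then show ?thesis
        by (subst hausdorff_outer_measure_def) (auto intro: SUP_least)
    qed
    then show ?thesis
      by (auto simp: countably_subadditive_def)
  qed
qed

lemma
  fixes A :: "'a::metric_space set"
  shows space_hausdorff_measure: "space (hausdorff_measure s :: 'a measure) = UNIV"
    and sets_hausdorff_measure:
      "sets (hausdorff_measure s :: 'a measure) = lambda_system UNIV UNIV (hausdorff_outer_measure s)"
    and emeasure_hausdorff_measure:
      "A \<in> sets (hausdorff_measure s) \<Longrightarrow> emeasure (hausdorff_measure s) A = hausdorff_outer_measure s A"
proof -
  have ms: "measure_space UNIV (lambda_system UNIV UNIV (hausdorff_outer_measure s))
      (hausdorff_outer_measure s :: 'a set \<Rightarrow> ennreal)"
    using sigma_algebra.caratheodory_lemma[OF sigma_algebra_Pow,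
        of UNIV "hausdorff_outer_measure s :: 'a set \<Rightarrow> ennreal"]
      outer_measure_space_hausdorff[of s, where 'a = 'a] by simp
  then have sa: "sigma_algebra UNIV (lambda_system UNIV UNIV (hausdorff_outer_measure s :: 'a set \<Rightarrow> ennreal))"
    by (simp add: measure_space_def)
  show "space (hausdorff_measure s :: 'a measure) = UNIV"
    by (simp add: hausdorff_measure_def)
  show sets: "sets (hausdorff_measure s :: 'a measure) = lambda_system UNIV UNIV (hausdorff_outer_measure s)"
    by (simp add: hausdorff_measure_def sigma_algebra.sigma_sets_eq[OF sa])
  show "emeasure (hausdorff_measure s) A = hausdorff_outer_measure s A"
    if "A \<in> sets (hausdorff_measure s)"
    using that ms unfolding sets unfolding hausdorff_measure_def measure_space_def
    by (intro emeasure_measure_of_sigma) auto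
qed


section \<open>Finite signed measures\<close>

text \<open>A set function \<open>\<mu>\<close> on the \<open>\<sigma>\<close>-algebra of \<open>M\<close>; only \<open>space M\<close> and \<open>sets M\<close> are used. Finiteness
  is built into the codomain.\<close>

definition finite_signed_measure :: "'a measure \<Rightarrow> ('a set \<Rightarrow> real) \<Rightarrow> bool" where
  "finite_signed_measure M \<mu> \<longleftrightarrow>
     \<mu> {} = 0 \<and>
     (\<forall>A :: nat \<Rightarrow> 'a set. range A \<subseteq> sets M \<longrightarrow> disjoint_family A \<longrightarrow>
        (\<lambda>i. \<mu> (A i)) sums \<mu> (\<Union>i. A i))"

definition signed_absolutely_continuous ::
    "'a measure \<Rightarrow> ('a set \<Rightarrow> real) \<Rightarrow> ('a set \<Rightarrow> ennreal) \<Rightarrow> bool" where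
  "signed_absolutely_continuous M \<mu> \<sigma> \<longleftrightarrow> (\<forall>E \<in> sets M. \<sigma> E = 0 \<longrightarrow> \<mu> E = 0)"

text \<open>The positive part \<open>\<mu>\<^sup>+(A) = sup {\<mu>(B) | B \<subseteq> A measurable}\<close> of the Jordan decomposition; the
  negative part of \<open>\<mu>\<close> is the positive part of \<open>-\<mu>\<close>. Truncation of negative values by \<^const>\<open>ennreal\<close>
  is harmless since \<open>B = {}\<close> already contributes 0.\<close>

definition positive_variation :: "'a measure \<Rightarrow> ('a set \<Rightarrow> real) \<Rightarrow> 'a measure" where
  "positive_variation M \<mu> =
     measure_of (space M) (sets M) (\<lambda>A. SUP B \<in> {B \<in> sets M. B \<subseteq> A}. ennreal (\<mu> B))"

definition signed_integral :: "'a measure \<Rightarrow> ('a set \<Rightarrow> real) \<Rightarrow> ('a \<Rightarrow> real) \<Rightarrow> real" where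
  "signed_integral M \<mu> f =
     integral\<^sup>L (positive_variation M \<mu>) f - integral\<^sup>L (positive_variation M (\<lambda>A. - \<mu> A)) f"

definition sphere_borel :: "'a::euclidean_space measure" where
  "sphere_borel = restrict_space borel (sphere 0 1)"

definition weakly_convergent_on_sphere ::
    "(nat \<Rightarrow> 'a::euclidean_space set \<Rightarrow> real) \<Rightarrow> ('a set \<Rightarrow> real) \<Rightarrow> bool" where
  "weakly_convergent_on_sphere \<mu>s \<mu> \<longleftrightarrow>
     (\<forall>f. continuous_on (sphere 0 1) f \<longrightarrow>
        (\<lambda>i. signed_integral sphere_borel (\<mu>s i) f) \<longlonglongrightarrow> signed_integral sphere_borel \<mu> f)"


section \<open>Convex bodies containing the origin\<close>

definition convex_bodies_o :: "'a::euclidean_space set set" where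
  "convex_bodies_o = {K. compact K \<and> convex K \<and> 0 \<in> K}"

definition support_function :: "'a::euclidean_space set \<Rightarrow> 'a \<Rightarrow> real" where
  "support_function K u = (SUP x \<in> K. u \<bullet> x)"

definition hausdorff_distance :: "'a::euclidean_space set \<Rightarrow> 'a set \<Rightarrow> real" where
  "hausdorff_distance K L = (SUP u \<in> sphere 0 1. \<bar>support_function K u - support_function L u\<bar>)"

definition normal_cone :: "'a::euclidean_space set \<Rightarrow> 'a \<Rightarrow> 'a set" where
  "normal_cone K z = {y. \<forall>x \<in> K. y \<bullet> (x - z) \<le> 0}"

definition radial_function :: "'a::euclidean_space set \<Rightarrow> 'a \<Rightarrow> real" where
  "radial_function K u = Sup {l. 0 \<le> l \<and> l *\<^sub>R u \<in> K}"

definition radial_map :: "'a::euclidean_space set \<Rightarrow> 'a \<Rightarrow> 'a" where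
  "radial_map K u = radial_function K u *\<^sub>R u"

definition reverse_spherical_image :: "'a::euclidean_space set \<Rightarrow> 'a set \<Rightarrow> 'a set" where
  "reverse_spherical_image K E = {x \<in> frontier K. normal_cone K x \<inter> E \<noteq> {}}"

definition reverse_radial_gauss_image :: "'a::euclidean_space set \<Rightarrow> 'a set \<Rightarrow> 'a set" where
  "reverse_radial_gauss_image K E =
     {u \<in> sphere 0 1. radial_map K u \<in> reverse_spherical_image K E}"

text \<open>A set function rather than a \<^typ>\<open>'a measure\<close>: if \<open>K\<close> has dimension \<open>n - 1\<close>, both unit
  normals of its hyperplane see all of \<open>K\<close>, and the formula is not additive.\<close>

definition surface_area_measure :: "'a::euclidean_space set \<Rightarrow> 'a set \<Rightarrow> ennreal" where
  "surface_area_measure K E = hausdorff_outer_measure (DIM('a) - 1) (reverse_spherical_image K E)"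


section \<open>The general dual Orlicz curvature measure\<close>

text \<open>\<open>G_t = \<partial>G/\<partial>t\<close>, used at points with \<open>t > 0\<close> only.\<close>

definition partial_t :: "(real \<Rightarrow> 'a \<Rightarrow> real) \<Rightarrow> real \<Rightarrow> 'a \<Rightarrow> real" where
  "partial_t G t u = deriv (\<lambda>s. G s u) t"

definition dual_curvature_domain :: "'a::euclidean_space set \<Rightarrow> 'a set \<Rightarrow> 'a set" where
  "dual_curvature_domain K E = reverse_radial_gauss_image K (E - normal_cone K 0)"

definition dual_curvature_integrand ::
    "(real \<Rightarrow> 'a::euclidean_space \<Rightarrow> real) \<Rightarrow> 'a set \<Rightarrow> 'a \<Rightarrow> real" where
  "dual_curvature_integrand G K u = radial_function K u * partial_t G (radial_function K u) u"

definition dual_curvature_integrable ::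
    "(real \<Rightarrow> 'a::euclidean_space \<Rightarrow> real) \<Rightarrow> 'a set \<Rightarrow> 'a set \<Rightarrow> bool" where
  "dual_curvature_integrable G K E \<longleftrightarrow>
     set_integrable (hausdorff_measure (DIM('a) - 1))
       (dual_curvature_domain K E) (dual_curvature_integrand G K)"

definition dual_curvature_measure ::
    "(real \<Rightarrow> 'a::euclidean_space \<Rightarrow> real) \<Rightarrow> 'a set \<Rightarrow> 'a set \<Rightarrow> real" where
  "dual_curvature_measure G K E =
     1 / real DIM('a) *
     set_lebesgue_integral (hausdorff_measure (DIM('a) - 1))
       (dual_curvature_domain K E) (dual_curvature_integrand G K)"

text \<open>Extension of \<open>f\<close> to \<open>t = 0\<close> by its right limit. If the extension is jointly continuous on
  \<open>[0, \<infinity>) \<times> S\<close>, the limit exists, because \<open>f t u\<close> then tends to the value at \<open>(0, u)\<close>.\<close>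

definition extend_to_zero :: "(real \<Rightarrow> 'a \<Rightarrow> real) \<Rightarrow> real \<Rightarrow> 'a \<Rightarrow> real" where
  "extend_to_zero f t u = (if t = 0 then Lim (at_right 0) (\<lambda>s. f s u) else f t u)"

end

theory Submission
  imports Defs
begin

text \<open>
  The curvature measure of \<open>K\<close> integrates over the directions \<open>u\<close> for which \<open>K\<close> has, at the boundary point
  \<open>radial_map K u\<close>, a unit normal \<open>v\<close> in a given set with \<open>0 < v \<bullet> radial_map K u\<close>; the inequality says that
  \<open>v\<close> is no normal at the origin. Everything rests on one exceptional set being null for the
  \<open>(n - 1)\<close>-dimensional Hausdorff measure: the directions \<open>u\<close> over which the map
  \<open>y \<mapsto> sgn (closest_point K y)\<close> has a fibre that contains a nondegenerate triangle
  (\<open>hausdorff_null_fat_fibre_directions\<close>). Such a triangle meets one of the countably many flats on which two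
  coordinates take prescribed rational values. These flats are null, and the map is locally Lipschitz where
  the projection is not the origin.

  If the fibre over \<open>u\<close> is not fat, two things hold. There is at most one admissible normal at
  \<open>radial_map K u\<close>, since two of them would span a sector of normals, all of whose translates project to the
  same point (\<open>normal_unique_off_fat_fibres\<close>). And if \<open>radial_function K u\<close> is positive, the ray of \<open>u\<close> meets
  the interior of \<open>K\<close>, since otherwise the strip over the segment in its normal direction projects into the
  ray (\<open>ray_meets_interior_off_fat_fibres\<close>).

  For the first assertion, uniqueness of the normal makes the curvature measure the push-forward, under the
  map from \<open>u\<close> to its normal, of the measure whose density is the integrand. Splitting the density into its
  positive and negative part yields a difference of two finite measures
  (\<open>dual_curvature_measure_decomposition\<close>).

  For the second assertion, the domain of integration is the radial projection of a part of
  \<open>reverse_spherical_image K E\<close> that avoids the origin. Radial projection is Lipschitz at positive distance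
  from the origin, so the domain is null whenever the surface area measure of \<open>E\<close> vanishes
  (\<open>dual_curvature_measure_eq_0\<close>).

  For the third assertion, the integral of \<open>f\<close> with respect to the curvature measure becomes an integral over
  directions of \<open>f\<close>, evaluated at the normal, times the density. For almost every direction both factors
  converge along \<open>Ks\<close>: either the radial functions tend to 0, and with them the densities, or the ray meets
  the interior of \<open>K\<close>, and the radial functions and the normals converge (\<open>carrier_density_tendsto\<close>).
  Dominated convergence applies because the sphere has finite measure.
\<close>

section \<open>Hausdorff null sets and finite Hausdorff measure\<close>

lemma hausdorff_premeasure_le_finite_cover:
  fixes A :: "'a::metric_space set"
  assumes "finite I" and sub: "A \<subseteq> (\<Union>i\<in>I. Q i)"
    and bdd: "\<And>i. i \<in> I \<Longrightarrow> bounded (Q i)" and diam: "\<And>i. i \<in> I \<Longrightarrow> diameter (Q i) \<le> e"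
    and "0 \<le> e" "e \<le> \<delta>"
  shows "hausdorff_premeasure s \<delta> A \<le> ennreal (real (card I) * (unit_ball_vol (real s) * (e / 2) ^ s))"
proof -
  obtain g where g: "bij_betw g {0..<card I} I"
    using ex_bij_betw_nat_finite[OF \<open>finite I\<close>] by blast
  define C where "C k = (if k < card I then Q (g k) else {})" for k
  have gI: "g k \<in> I" if "k < card I" for k
    using g that by (auto simp: bij_betw_def)
  have "A \<subseteq> (\<Union>k. C k)"
  proof
    fix x assume "x \<in> A"
    then obtain i where i: "i \<in> I" "x \<in> Q i" using sub by blast
    then obtain k where "k < card I" "g k = i"
      using g by (force simp: bij_betw_def)
    then have "x \<in> C k" using i by (simp add: C_def)
    then show "x \<in> (\<Union>k. C k)" by blast
  qed
  moreover have "bounded (C k)" "diameter (C k) \<le> \<delta>" for k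
    using gI[of k] bdd diam[of "g k"] \<open>0 \<le> e\<close> \<open>e \<le> \<delta>\<close> by (auto simp: C_def)
  ultimately have "hausdorff_premeasure s \<delta> A \<le>
      (\<Sum>k. if C k = {} then 0 else ennreal (unit_ball_vol (real s) * (diameter (C k) / 2) ^ s))"
    unfolding hausdorff_premeasure_def by (intro INF_lower) auto
  also have "\<dots> = (\<Sum>k<card I. if C k = {} then 0 else ennreal (unit_ball_vol (real s) * (diameter (C k) / 2) ^ s))"
    by (rule suminf_finite) (auto simp: C_def)
  also have "\<dots> \<le> (\<Sum>k<card I. ennreal (unit_ball_vol (real s) * (e / 2) ^ s))"
  proof (rule sum_mono)
    fix k assume "k \<in> {..<card I}"
    then have "bounded (C k)" "diameter (C k) \<le> e"
      using gI[of k] bdd diam by (auto simp: C_def)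
    then show "(if C k = {} then 0 else ennreal (unit_ball_vol (real s) * (diameter (C k) / 2) ^ s))
        \<le> ennreal (unit_ball_vol (real s) * (e / 2) ^ s)"
      by (auto intro!: ennreal_leI mult_left_mono power_mono divide_right_mono diameter_ge_0)
  qed
  also have "\<dots> = ennreal (real (card I) * (unit_ball_vol (real s) * (e / 2) ^ s))"
    using \<open>0 \<le> e\<close> by (simp add: ennreal_mult ennreal_of_nat_eq_real_of_nat)
  finally show ?thesis .
qed

lemma hausdorff_outer_measure_mono:
  "A \<subseteq> B \<Longrightarrow> hausdorff_outer_measure s A \<le> hausdorff_outer_measure s B"
  using outer_measure_space_hausdorff[of s] by (auto simp: outer_measure_space_def increasing_def)

lemma hausdorff_outer_measure_UN_le:
  fixes A :: "nat \<Rightarrow> 'a::metric_space set"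
  shows "hausdorff_outer_measure s (\<Union>i. A i) \<le> (\<Sum>i. hausdorff_outer_measure s (A i))"
proof -
  have sub: "hausdorff_premeasure s \<delta> (\<Union>i. A i) \<le> (\<Sum>i. hausdorff_outer_measure s (A i))"
    if "0 < \<delta>" for \<delta>
    by (rule order_trans[OF hausdorff_premeasure_countably_subadditive suminf_le])
       (use that in \<open>auto simp: hausdorff_outer_measure_def intro: SUP_upper\<close>)
  show ?thesis
    unfolding hausdorff_outer_measure_def[of s "\<Union>i. A i"] by (rule SUP_least) (use sub in auto)
qed

lemma hausdorff_null_countable_Union:
  assumes "countable \<A>" and null: "\<And>A. A \<in> \<A> \<Longrightarrow> hausdorff_outer_measure s A = 0"
  shows "hausdorff_outer_measure s (\<Union>\<A>) = 0"
proof (cases "\<A> = {}")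
  case True
  have "hausdorff_outer_measure s ({} :: 'a set) = 0"
    using outer_measure_space_hausdorff[of s, where 'a = 'a]
    by (simp add: outer_measure_space_def positive_def)
  with True show ?thesis by simp
next
  case False
  then obtain f :: "nat \<Rightarrow> 'a set" where f: "range f = \<A>"
    using \<open>countable \<A>\<close> by (metis range_from_nat_into)
  have "hausdorff_outer_measure s (f i) = 0" for i
    using null f by blast
  then have "hausdorff_outer_measure s (\<Union>i. f i) \<le> 0"
    using hausdorff_outer_measure_UN_le[of s f] by simp
  with f show ?thesis by simp
qed

lemma hausdorff_finite_Union:
  assumes "finite \<A>" and fin: "\<And>A. A \<in> \<A> \<Longrightarrow> hausdorff_outer_measure s A < top"
  shows "hausdorff_outer_measure s (\<Union>\<A>) < top"
proof -
  obtain g where g: "bij_betw g {0..<card \<A>} \<A>"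
    using ex_bij_betw_nat_finite[OF \<open>finite \<A>\<close>] by blast
  define C where "C k = (if k < card \<A> then g k else {})" for k
  have zero: "hausdorff_outer_measure s ({} :: 'a set) = 0"
    using hausdorff_null_countable_Union[of "{}" s] by simp
  have "\<Union>\<A> = (\<Union>k. C k)"
  proof -
    have "\<Union>\<A> = (\<Union>k\<in>{0..<card \<A>}. g k)"
      using bij_betw_imp_surj_on[OF g] by simp
    also have "\<dots> = (\<Union>k. C k)"
      by (auto simp: C_def split: if_splits)
    finally show ?thesis .
  qed
  then have "hausdorff_outer_measure s (\<Union>\<A>) \<le> (\<Sum>k. hausdorff_outer_measure s (C k))"
    using hausdorff_outer_measure_UN_le[of s C] by simp
  also have "\<dots> = (\<Sum>k<card \<A>. hausdorff_outer_measure s (C k))"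
    by (rule suminf_finite) (auto simp: C_def zero)
  also have "\<dots> < top"
    using bij_betw_apply[OF g] fin by (simp add: C_def)
  finally show ?thesis .
qed

lemma hausdorff_null_in_null_sets:
  assumes "hausdorff_outer_measure s A = 0"
  shows "A \<in> null_sets (hausdorff_measure s)"
proof -
  have "hausdorff_outer_measure s (A \<inter> X) + hausdorff_outer_measure s (- A \<inter> X)
      = hausdorff_outer_measure s X" for X
  proof -
    have A: "hausdorff_outer_measure s (A \<inter> X) = 0"
      using hausdorff_outer_measure_mono[of "A \<inter> X" A s] assms by simp
    have "X \<subseteq> (\<Union>i::nat. if i = 0 then A \<inter> X else if i = 1 then - A \<inter> X else {})"
    proof
      fix x assume "x \<in> X"
      then have "x \<in> (if (if x \<in> A then 0 else 1::nat) = 0 then A \<inter> X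
          else if (if x \<in> A then 0 else 1::nat) = 1 then - A \<inter> X else {})" by simp
      then show "x \<in> (\<Union>i::nat. if i = 0 then A \<inter> X else if i = 1 then - A \<inter> X else {})" by blast
    qed
    then have "hausdorff_outer_measure s X \<le>
        (\<Sum>i::nat. hausdorff_outer_measure s (if i = 0 then A \<inter> X else if i = 1 then - A \<inter> X else {}))"
      by (rule order_trans[OF hausdorff_outer_measure_mono hausdorff_outer_measure_UN_le])
    also have "\<dots> = (\<Sum>i\<in>{0,1::nat}. hausdorff_outer_measure s (if i = 0 then A \<inter> X else if i = 1 then - A \<inter> X else {}))"
      by (rule suminf_finite) (use hausdorff_null_countable_Union[of "{}" s] in auto)
    finally have "hausdorff_outer_measure s X \<le> hausdorff_outer_measure s (- A \<inter> X)"
      using A by simp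
    moreover have "hausdorff_outer_measure s (- A \<inter> X) \<le> hausdorff_outer_measure s X"
      by (rule hausdorff_outer_measure_mono) auto
    ultimately show ?thesis using A by (simp add: antisym)
  qed
  then have "A \<in> sets (hausdorff_measure s)"
    by (simp add: sets_hausdorff_measure lambda_system_def Compl_eq_Diff_UNIV)
  then show ?thesis
    using assms by (simp add: null_sets_def emeasure_hausdorff_measure)
qed

lemma hausdorff_outer_measure_lipschitz_image:
  fixes f :: "'a::metric_space \<Rightarrow> 'b::metric_space"
  assumes "0 < L" and lip: "\<And>x y. x \<in> A \<Longrightarrow> y \<in> A \<Longrightarrow> dist (f x) (f y) \<le> L * dist x y"
  shows "hausdorff_outer_measure s (f ` A) \<le> ennreal (L ^ s) * hausdorff_outer_measure s A"
proof -
  have "hausdorff_premeasure s \<delta> (f ` A) \<le> ennreal (L ^ s) * hausdorff_outer_measure s A"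
    if "0 < \<delta>" for \<delta>
  proof -
    define w where "w C = (if C = {} then 0 else ennreal (unit_ball_vol (real s) * (diameter C / 2) ^ s))"
      for C :: "'a set"
    have "hausdorff_premeasure s \<delta> (f ` A) \<le> ennreal (L ^ s) * (\<Sum>i. w (C i))"
      if C: "A \<subseteq> (\<Union>i. C i)" "\<And>i. bounded (C i)" "\<And>i. diameter (C i) \<le> \<delta> / L" for C :: "nat \<Rightarrow> 'a set"
    proof -
      define D where "D i = f ` (A \<inter> C i)" for i
      have dist: "dist x y \<le> L * diameter (C i)" if xy: "x \<in> D i" "y \<in> D i" for i x y
      proof -
        obtain a b where "a \<in> A \<inter> C i" "b \<in> A \<inter> C i" "x = f a" "y = f b"
          using xy unfolding D_def by blast
        then have "dist x y \<le> L * dist a b" "dist a b \<le> diameter (C i)"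
          using lip C(2) by (auto intro: diameter_bounded_bound)
        then show ?thesis
          using \<open>0 < L\<close> by (meson less_imp_le mult_left_mono order_trans)
      qed
      have bdd: "bounded (D i)" for i
        by (rule bounded_two_points[THEN iffD2]) (use dist in blast)
      have diam: "diameter (D i) \<le> L * diameter (C i)" for i
      proof (cases "D i = {}")
        case True
        then show ?thesis using \<open>0 < L\<close> diameter_ge_0[OF C(2)] by simp
      next
        case False
        then show ?thesis
          unfolding diameter_def[of "D i"] by (auto intro!: cSUP_least dist)
      qed
      have sub: "f ` A \<subseteq> (\<Union>i. D i)"
      proof
        fix y assume "y \<in> f ` A"
        then obtain x where x: "x \<in> A" "y = f x" by blast
        then obtain i where "x \<in> C i" using C(1) by blast
        with x have "y \<in> D i" by (simp add: D_def)
        then show "y \<in> (\<Union>i. D i)" by blast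
      qed
      have diam': "diameter (D i) \<le> \<delta>" for i
        using diam[of i] C(3)[of i] \<open>0 < L\<close> by (simp add: field_simps)
      have "hausdorff_premeasure s \<delta> (f ` A) \<le>
         (\<Sum>i. if D i = {} then 0 else ennreal (unit_ball_vol (real s) * (diameter (D i) / 2) ^ s))"
        unfolding hausdorff_premeasure_def by (intro INF_lower) (use sub bdd diam' in auto)
      also have "\<dots> \<le> (\<Sum>i. ennreal (L ^ s) * w (C i))"
      proof (intro suminf_le)
        fix i
        have "(diameter (D i) / 2) ^ s \<le> L ^ s * (diameter (C i) / 2) ^ s"
          using diam[of i] diameter_ge_0[OF bdd, of i] unfolding power_mult_distrib[symmetric]
          by (intro power_mono) auto
        then have "unit_ball_vol (real s) * (diameter (D i) / 2) ^ s
            \<le> L ^ s * (unit_ball_vol (real s) * (diameter (C i) / 2) ^ s)"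
          by (simp add: mult.left_commute mult_left_mono)
        moreover have "C i \<noteq> {}" if "D i \<noteq> {}"
          using that by (auto simp: D_def)
        ultimately show "(if D i = {} then 0 else ennreal (unit_ball_vol (real s) * (diameter (D i) / 2) ^ s))
            \<le> ennreal (L ^ s) * w (C i)"
          using \<open>0 < L\<close> diameter_ge_0[OF C(2), of i]
          by (auto simp: w_def ennreal_mult[symmetric] intro!: ennreal_leI)
      qed auto
      finally show ?thesis by simp
    qed
    then have "hausdorff_premeasure s \<delta> (f ` A) / ennreal (L ^ s) \<le> (\<Sum>i. w (C i))"
      if "A \<subseteq> (\<Union>i. C i)" "\<And>i. bounded (C i)" "\<And>i. diameter (C i) \<le> \<delta> / L" for C :: "nat \<Rightarrow> 'a set"
      using that \<open>0 < L\<close> by (intro divide_le_posI_ennreal) (auto simp: mult.commute)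
    then have "hausdorff_premeasure s \<delta> (f ` A) / ennreal (L ^ s) \<le> hausdorff_premeasure s (\<delta> / L) A"
      unfolding hausdorff_premeasure_def[of s "\<delta> / L"] w_def by (intro INF_greatest) auto
    then have "ennreal (L ^ s) * (hausdorff_premeasure s \<delta> (f ` A) / ennreal (L ^ s))
        \<le> ennreal (L ^ s) * hausdorff_premeasure s (\<delta> / L) A"
      by (intro mult_left_mono) auto
    moreover have "ennreal (L ^ s) * (hausdorff_premeasure s \<delta> (f ` A) / ennreal (L ^ s))
        = hausdorff_premeasure s \<delta> (f ` A)"
      using \<open>0 < L\<close> by (subst ennreal_times_divide, subst mult.commute, subst mult_divide_eq_ennreal) auto
    ultimately have "hausdorff_premeasure s \<delta> (f ` A) \<le> ennreal (L ^ s) * hausdorff_premeasure s (\<delta> / L) A"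
      by simp
    also have "\<dots> \<le> ennreal (L ^ s) * hausdorff_outer_measure s A"
      unfolding hausdorff_outer_measure_def using that \<open>0 < L\<close>
      by (intro mult_left_mono SUP_upper) auto
    finally show ?thesis .
  qed
  then show ?thesis
    unfolding hausdorff_outer_measure_def[of s "f ` A"] by (intro SUP_least) auto
qed

text \<open>Subdividing the \<open>k = card J\<close> free sides of the box into \<open>N\<close> parts covers it by \<open>N ^ k\<close> sets of diameter
  \<open>O (1 / N)\<close>. The covering sums \<open>O (N ^ k / N ^ d)\<close> are bounded for \<open>k = d\<close> and vanish in the limit
  for \<open>k < d\<close>.\<close>

lemma hausdorff_premeasure_box_le:
  fixes c :: "real ^ 'n" and m :: real
  assumes "0 < m" "0 < N" and N: "real CARD('n) * (2 * m / real N) \<le> \<delta>"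
  shows "hausdorff_premeasure d \<delta> {x. (\<forall>i\<in>J. \<bar>x $ i\<bar> \<le> m) \<and> (\<forall>i. i \<notin> J \<longrightarrow> x $ i = c $ i)}
     \<le> ennreal (real (N ^ card J) * (unit_ball_vol (real d) * (real CARD('n) * m / real N) ^ d))"
    (is "hausdorff_premeasure d \<delta> ?B \<le> _")
proof -
  define Q where "Q f = {x::real^'n. \<forall>i. if i \<in> J
      then - m + 2 * m * real (f i) / real N \<le> x $ i \<and> x $ i \<le> - m + 2 * m * real (f i + 1) / real N
      else x $ i = c $ i}" for f :: "'n \<Rightarrow> nat"
  define I where "I = PiE J (\<lambda>_. {0..<N})"
  have fin: "finite I" and card: "card I = N ^ card J"
    by (auto simp: I_def card_PiE finite_PiE)
  have "\<exists>f\<in>I. x \<in> Q f" if x: "x \<in> ?B" for x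
  proof -
    \<comment> \<open>The minimum puts the right end point \<open>m\<close> into the last subinterval.\<close>
    define g where "g i = min (N - 1) (nat \<lfloor>(x $ i + m) * real N / (2 * m)\<rfloor>)" for i
    have "- m + 2 * m * real (g i) / real N \<le> x $ i \<and> x $ i \<le> - m + 2 * m * real (g i + 1) / real N"
      if "i \<in> J" for i
    proof -
      define y where "y = (x $ i + m) * real N / (2 * m)"
      have xm: "- m \<le> x $ i" "x $ i \<le> m"
        using x that by (auto simp: abs_le_iff)
      then have y0: "0 \<le> y" using assms by (simp add: y_def)
      have xi: "x $ i = - m + 2 * m * y / real N"
        using assms by (simp add: y_def field_simps)
      have "(x $ i + m) * real N \<le> (2 * m) * real N"
        using xm by (intro mult_right_mono) auto
      then have yN: "y \<le> real N"
        using assms by (simp add: y_def field_simps)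
      have fl: "real (nat \<lfloor>y\<rfloor>) \<le> y" "y \<le> real (nat \<lfloor>y\<rfloor>) + 1"
        using y0 by linarith+
      have gi: "g i = min (N - 1) (nat \<lfloor>y\<rfloor>)"
        by (simp add: g_def y_def)
      have "real (g i) \<le> y"
        using fl(1) unfolding gi by linarith
      moreover have "y \<le> real (g i + 1)"
        using fl(2) yN \<open>0 < N\<close> unfolding gi by (auto simp: min_def of_nat_diff)
      ultimately have "2 * m * real (g i) / real N \<le> 2 * m * y / real N"
        "2 * m * y / real N \<le> 2 * m * real (g i + 1) / real N"
        using assms by (auto intro!: divide_right_mono mult_left_mono)
      with xi show ?thesis by linarith
    qed
    then have "x \<in> Q (restrict g J)"
      using x by (auto simp: Q_def)
    moreover have "restrict g J \<in> I"
      using \<open>0 < N\<close> by (auto simp: I_def g_def)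
    ultimately show ?thesis by blast
  qed
  then have sub: "?B \<subseteq> (\<Union>f\<in>I. Q f)" by blast
  have dist: "norm (x - y) \<le> real CARD('n) * (2 * m / real N)" if "x \<in> Q f" "y \<in> Q f" for x y f
  proof -
    have "\<bar>(x - y) $ i\<bar> \<le> 2 * m / real N" for i
    proof (cases "i \<in> J")
      case True
      have *: "2 * m * real (f i + 1) / real N = 2 * m * real (f i) / real N + 2 * m / real N"
        by (simp add: add_divide_distrib distrib_left)
      from that True have "- m + 2 * m * real (f i) / real N \<le> x $ i" "x $ i \<le> - m + 2 * m * real (f i + 1) / real N"
        "- m + 2 * m * real (f i) / real N \<le> y $ i" "y $ i \<le> - m + 2 * m * real (f i + 1) / real N"
        unfolding Q_def mem_Collect_eq by metis+
      then show ?thesis unfolding * by (simp add: abs_le_iff)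
    next
      case False
      from that False have "x $ i = c $ i" "y $ i = c $ i"
        unfolding Q_def mem_Collect_eq by metis+
      then show ?thesis using assms by simp
    qed
    then have "(\<Sum>i\<in>UNIV. \<bar>(x - y) $ i\<bar>) \<le> (\<Sum>i\<in>(UNIV :: 'n set). 2 * m / real N)"
      by (intro sum_mono) auto
    then show ?thesis
      using norm_le_l1_cart[of "x - y"] by simp
  qed
  have bdd: "bounded (Q f)" for f
    unfolding bounded_two_points dist_norm using dist by blast
  have diam: "diameter (Q f) \<le> real CARD('n) * (2 * m / real N)" for f
    by (rule diameter_le) (use dist assms in auto)
  have "hausdorff_premeasure d \<delta> ?B \<le> ennreal (real (card I) *
      (unit_ball_vol (real d) * (real CARD('n) * (2 * m / real N) / 2) ^ d))"
    by (rule hausdorff_premeasure_le_finite_cover[OF fin sub bdd diam _ N]) (use assms in auto)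
  then show ?thesis
    by (simp add: card mult.commute)
qed

lemma eventually_box_mesh_le:
  fixes m :: real
  assumes "0 < \<delta>"
  shows "\<forall>\<^sub>F N in sequentially. 0 < N \<and> real CARD('n::finite) * (2 * m / real N) \<le> \<delta>"
proof -
  have "(\<lambda>N. real CARD('n) * (2 * m) / real N) \<longlonglongrightarrow> 0"
    by (rule lim_const_over_n)
  then have "\<forall>\<^sub>F N in sequentially. real CARD('n) * (2 * m) / real N < \<delta>"
    using assms by (rule order_tendstoD)
  with eventually_gt_at_top[of "0::nat"] show ?thesis
    by eventually_elim (auto simp: field_simps)
qed

lemma hausdorff_box_finite:
  fixes c :: "real ^ 'n" and m :: real
  assumes "0 < m" "card J = d"
  shows "hausdorff_outer_measure d {x. (\<forall>i\<in>J. \<bar>x $ i\<bar> \<le> m) \<and> (\<forall>i. i \<notin> J \<longrightarrow> x $ i = c $ i)} < top"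
    (is "hausdorff_outer_measure d ?B < top")
proof -
  have "hausdorff_premeasure d \<delta> ?B \<le> ennreal (unit_ball_vol (real d) * (real CARD('n) * m) ^ d)"
    if "0 < \<delta>" for \<delta>
  proof -
    obtain N where N: "0 < N" "real CARD('n) * (2 * m / real N) \<le> \<delta>"
      using eventually_happens'[OF sequentially_bot eventually_box_mesh_le[OF \<open>0 < \<delta>\<close>, where 'n = 'n and m = m]]
      by blast
    have eq: "real (N ^ card J) * (unit_ball_vol (real d) * (real CARD('n) * m / real N) ^ d)
        = unit_ball_vol (real d) * (real CARD('n) * m) ^ d"
      using N(1) by (simp add: assms(2) power_divide)
    show ?thesis
      using hausdorff_premeasure_box_le[OF \<open>0 < m\<close> N, of d J c] unfolding eq .
  qed
  then have "hausdorff_outer_measure d ?B \<le> ennreal (unit_ball_vol (real d) * (real CARD('n) * m) ^ d)"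
    unfolding hausdorff_outer_measure_def by (intro SUP_least) auto
  then show ?thesis
    by (rule order_le_less_trans) simp
qed

lemma hausdorff_box_null:
  fixes c :: "real ^ 'n" and m :: real
  assumes "0 < m" "card J < d"
  shows "hausdorff_outer_measure d {x. (\<forall>i\<in>J. \<bar>x $ i\<bar> \<le> m) \<and> (\<forall>i. i \<notin> J \<longrightarrow> x $ i = c $ i)} = 0"
    (is "hausdorff_outer_measure d ?B = 0")
proof -
  define C where "C = unit_ball_vol (real d) * (real CARD('n) * m) ^ d"
  have "hausdorff_premeasure d \<delta> ?B \<le> 0" if "0 < \<delta>" for \<delta>
  proof (rule tendsto_lowerbound)
    have "(\<lambda>N. C / real N) \<longlonglongrightarrow> 0"
      by (rule lim_const_over_n)
    then show "(\<lambda>N. ennreal (C / real N)) \<longlonglongrightarrow> 0"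
      by (rule tendsto_ennrealI[of _ 0, unfolded ennreal_0])
    show "\<forall>\<^sub>F N in sequentially. hausdorff_premeasure d \<delta> ?B \<le> ennreal (C / real N)"
      using eventually_box_mesh_le[OF \<open>0 < \<delta>\<close>, where 'n = 'n and m = m]
    proof eventually_elim
      case (elim N)
      have "real (N ^ card J) * (unit_ball_vol (real d) * (real CARD('n) * m / real N) ^ d)
          = C * (real N ^ card J / real N ^ d)"
        by (simp add: C_def power_divide)
      also have "real N ^ card J / real N ^ d = 1 / real N ^ (d - card J)"
        using elim assms by (simp add: power_diff)
      also have "C * (1 / real N ^ (d - card J)) \<le> C * (1 / real N)"
      proof (intro mult_left_mono divide_left_mono)
        show "real N \<le> real N ^ (d - card J)"
          using elim assms by (intro self_le_power) auto
      qed (use elim assms in \<open>auto simp: C_def\<close>)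
      finally have "real (N ^ card J) * (unit_ball_vol (real d) * (real CARD('n) * m / real N) ^ d)
          \<le> C / real N" by simp
      with hausdorff_premeasure_box_le[OF \<open>0 < m\<close>, of N \<delta> d J c] elim show ?case
        by (meson ennreal_leI order_trans)
    qed
  qed simp
  then show ?thesis
    unfolding hausdorff_outer_measure_def by (auto intro!: antisym SUP_least)
qed

lemma hausdorff_null_subset:
  "A \<subseteq> B \<Longrightarrow> hausdorff_outer_measure s B = 0 \<Longrightarrow> hausdorff_outer_measure s A = 0"
  using hausdorff_outer_measure_mono[of A B s] by simp

lemma hausdorff_null_codim2_flat:
  fixes p q :: real
  assumes "i \<noteq> j"
  shows "hausdorff_outer_measure (CARD('n) - 1) {x :: real ^ 'n. x $ i = p \<and> x $ j = q} = 0"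
proof -
  define J where "J = UNIV - {i, j}"
  define c :: "real ^ 'n" where "c = (\<chi> k. if k = i then p else q)"
  define B where "B m = {x :: real^'n. (\<forall>i\<in>J. \<bar>x $ i\<bar> \<le> real (Suc m)) \<and> (\<forall>i. i \<notin> J \<longrightarrow> x $ i = c $ i)}" for m
  have "card {i, j} \<le> CARD('n)"
    by (rule card_mono) auto
  then have "card J < CARD('n) - 1"
    using assms by (simp add: J_def card_Diff_subset)
  then have "hausdorff_outer_measure (CARD('n) - 1) (\<Union>(range B)) = 0"
    by (intro hausdorff_null_countable_Union) (auto simp: B_def intro!: hausdorff_box_null simp del: of_nat_Suc)
  moreover have "{x :: real ^ 'n. x $ i = p \<and> x $ j = q} \<subseteq> \<Union>(range B)"
  proof
    fix x :: "real ^ 'n" assume x: "x \<in> {x. x $ i = p \<and> x $ j = q}"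
    have "x \<in> B (nat \<lceil>norm x\<rceil>)"
    proof -
      have "\<bar>x $ k\<bar> \<le> real (Suc (nat \<lceil>norm x\<rceil>))" for k
        using component_le_norm_cart[of x k] by linarith
      then show ?thesis
        using x assms by (auto simp: B_def J_def c_def)
    qed
    then show "x \<in> \<Union>(range B)" by blast
  qed
  ultimately show ?thesis
    by (rule hausdorff_null_subset[rotated])
qed

lemma sgn_lipschitz_away_from_zero:
  fixes x y :: "'a::real_normed_vector"
  assumes "0 < e" "e \<le> norm x" "e \<le> norm y"
  shows "dist (sgn x) (sgn y) \<le> (2 / e) * dist x y"
proof -
  have x0: "0 < norm x" and y0: "0 < norm y" using assms by linarith+
  have "sgn x - sgn y = (x - y) /\<^sub>R norm x + (inverse (norm x) - inverse (norm y)) *\<^sub>R y"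
    by (simp add: sgn_div_norm algebra_simps)
  then have "norm (sgn x - sgn y)
      \<le> norm ((x - y) /\<^sub>R norm x) + norm ((inverse (norm x) - inverse (norm y)) *\<^sub>R y)"
    by (metis norm_triangle_ineq)
  also have "norm ((inverse (norm x) - inverse (norm y)) *\<^sub>R y) = \<bar>norm y - norm x\<bar> / norm x"
  proof -
    have "inverse (norm x) - inverse (norm y) = (norm y - norm x) / (norm x * norm y)"
      using x0 y0 by (simp add: field_simps)
    then show ?thesis using x0 y0 by (simp add: abs_mult abs_divide)
  qed
  also have "\<bar>norm y - norm x\<bar> / norm x \<le> norm (x - y) / norm x"
    using x0 norm_triangle_ineq3[of y x] by (intro divide_right_mono) (auto simp: norm_minus_commute)
  also have "norm ((x - y) /\<^sub>R norm x) + norm (x - y) / norm x = 2 * norm (x - y) / norm x"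
    using x0 by (simp add: divide_inverse)
  also have "\<dots> \<le> 2 * norm (x - y) / e"
    using assms x0 by (intro divide_left_mono) auto
  finally show ?thesis by (simp add: dist_norm)
qed

text \<open>Although \<^const>\<open>sgn\<close> is not Lipschitz near the origin, the sets \<open>{x. 1 / m \<le> norm x}\<close> exhaust
  the complement of the origin.\<close>

lemma hausdorff_null_sgn_image:
  fixes A :: "'a::real_normed_vector set"
  assumes "hausdorff_outer_measure s A = 0" "0 \<notin> A"
  shows "hausdorff_outer_measure s (sgn ` A) = 0"
proof -
  define A' where "A' m = A \<inter> {x. 1 / real (Suc m) \<le> norm x}" for m
  have "hausdorff_outer_measure s (sgn ` A' m) = 0" for m
  proof -
    have "hausdorff_outer_measure s (sgn ` A' m)
        \<le> ennreal ((2 / (1 / real (Suc m))) ^ s) * hausdorff_outer_measure s (A' m)"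
      by (rule hausdorff_outer_measure_lipschitz_image)
         (use sgn_lipschitz_away_from_zero[of "1 / real (Suc m)"] in
           \<open>auto simp: A'_def simp del: of_nat_Suc\<close>)
    moreover have "hausdorff_outer_measure s (A' m) = 0"
      using hausdorff_outer_measure_mono[of "A' m" A s] assms by (simp add: A'_def)
    ultimately show ?thesis by simp
  qed
  then have "hausdorff_outer_measure s (\<Union>(range (\<lambda>m. sgn ` A' m))) = 0"
    by (intro hausdorff_null_countable_Union) auto
  moreover have "sgn ` A \<subseteq> \<Union>(range (\<lambda>m. sgn ` A' m))"
  proof
    fix y assume "y \<in> sgn ` A"
    then obtain x where x: "x \<in> A" "y = sgn x" by blast
    then have "0 < norm x" using assms by auto
    then obtain m where "1 / real (Suc m) < norm x"
      using nat_approx_posE by blast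
    with x have "y \<in> sgn ` A' m" by (auto simp: A'_def)
    then show "y \<in> \<Union>(range (\<lambda>m. sgn ` A' m))" by blast
  qed
  ultimately show ?thesis
    by (rule hausdorff_null_subset[rotated])
qed

text \<open>The sphere is the radial projection of the \<open>2 n\<close> facets of the cube \<open>[-1, 1] ^ n\<close>.\<close>

lemma hausdorff_sphere_finite:
  "hausdorff_outer_measure (CARD('n) - 1) (sphere (0 :: real ^ 'n) 1) < top"
proof -
  define F where "F = (\<lambda>(k :: 'n, c :: real).
    {x :: real^'n. (\<forall>i\<in>UNIV - {k}. \<bar>x $ i\<bar> \<le> 1) \<and> (\<forall>i. i \<notin> UNIV - {k} \<longrightarrow> x $ i = (\<chi> i. c) $ i)})"
  have "hausdorff_outer_measure (CARD('n) - 1) (sgn ` F kc) < top" if kc01: "kc \<in> UNIV \<times> {1, -1}" for kc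
  proof -
    obtain k c where kc: "kc = (k, c)" and c: "c = 1 \<or> c = -1"
      using kc01 by (cases kc) auto
    have F1: "1 \<le> norm x" if "x \<in> F kc" for x
      using that c component_le_norm_cart[of x k] by (auto simp: F_def kc)
    have "hausdorff_outer_measure (CARD('n) - 1) (sgn ` F kc)
        \<le> ennreal ((2 / 1) ^ (CARD('n) - 1)) * hausdorff_outer_measure (CARD('n) - 1) (F kc)"
      by (rule hausdorff_outer_measure_lipschitz_image)
         (use F1 sgn_lipschitz_away_from_zero[of 1] in auto)
    also have "\<dots> < top"
    proof -
      have "hausdorff_outer_measure (CARD('n) - 1) (F kc) < top"
        unfolding F_def kc prod.case by (intro hausdorff_box_finite) (auto simp: card_Diff_subset)
      then show ?thesis by (intro ennreal_mult_less_top[THEN iffD2]) auto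
    qed
    finally show ?thesis .
  qed
  then have "hausdorff_outer_measure (CARD('n) - 1) (\<Union>((\<lambda>kc. sgn ` F kc) ` (UNIV \<times> {1, -1}))) < top"
    by (intro hausdorff_finite_Union) auto
  moreover have "sphere 0 1 \<subseteq> \<Union>((\<lambda>kc. sgn ` F kc) ` (UNIV \<times> {1, -1}))"
  proof
    fix u :: "real ^ 'n" assume "u \<in> sphere 0 1"
    then have u: "norm u = 1" by simp
    obtain k where k: "\<And>i. \<bar>u $ i\<bar> \<le> \<bar>u $ k\<bar>"
    proof -
      have "Max (range (\<lambda>i. \<bar>u $ i\<bar>)) \<in> range (\<lambda>i. \<bar>u $ i\<bar>)"
        by (rule Max_in) auto
      then obtain k where k: "Max (range (\<lambda>i. \<bar>u $ i\<bar>)) = \<bar>u $ k\<bar>" by (rule imageE)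
      have "\<bar>u $ i\<bar> \<le> \<bar>u $ k\<bar>" for i
        unfolding k[symmetric] by (rule Max_ge) auto
      then show ?thesis by (rule that)
    qed
    have uk: "u $ k \<noteq> 0"
    proof
      assume "u $ k = 0"
      then have "u = 0" using k by (simp add: vec_eq_iff)
      with u show False by simp
    qed
    define y where "y = u /\<^sub>R \<bar>u $ k\<bar>"
    have "y \<in> F (k, sgn (u $ k))"
      using k uk by (auto simp: F_def y_def sgn_div_norm divide_simps)
    moreover have "sgn y = u"
      using uk u by (simp add: y_def sgn_scaleR sgn_div_norm)
    moreover have "sgn (u $ k) \<in> {1, -1}"
      using uk by (auto simp: sgn_if)
    ultimately have "u \<in> sgn ` F (k, sgn (u $ k))" "(k, sgn (u $ k)) \<in> UNIV \<times> {1, -1}" by blast+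
    then show "u \<in> \<Union>((\<lambda>kc. sgn ` F kc) ` (UNIV \<times> {1, -1}))" by blast
  qed
  ultimately show ?thesis
    by (rule order_le_less_trans[OF hausdorff_outer_measure_mono, rotated])
qed

section \<open>Directions whose fibre under the radial metric projection is two-dimensional\<close>

text \<open>Two independent vectors have a nonzero minor, in coordinates \<open>i\<close> and \<open>j\<close> say. The projection to these
  two coordinates maps the open triangle onto an open set of the plane, which contains a rational point.\<close>

lemma triangle_meets_rational_codim2_flat:
  fixes a p q :: "real ^ 'n"
  assumes "p \<noteq> 0" and indep: "\<And>c. q \<noteq> c *\<^sub>R p"
  obtains i j s t where "i \<noteq> j" "0 < s" "0 < t" "s + t < 1"
    "(a + s *\<^sub>R p + t *\<^sub>R q) $ i \<in> \<rat>" "(a + s *\<^sub>R p + t *\<^sub>R q) $ j \<in> \<rat>"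
proof -
  obtain i where i: "p $ i \<noteq> 0"
    using \<open>p \<noteq> 0\<close> by (auto simp: vec_eq_iff)
  obtain j where j: "q $ j \<noteq> (q $ i / p $ i) * p $ j"
    using indep[of "q $ i / p $ i"] by (auto simp: vec_eq_iff)
  define D where "D = p $ i * q $ j - p $ j * q $ i"
  have D: "D \<noteq> 0" and ij: "i \<noteq> j"
    using i j by (auto simp: D_def field_simps)
  \<comment> \<open>\<open>S\<close> and \<open>T\<close> solve for the coefficients by Cramer's rule, given the coordinates \<open>i\<close> and \<open>j\<close>.\<close>
  define S where "S = (\<lambda>z. ((fst z - a $ i) * q $ j - (snd z - a $ j) * q $ i) / D)"
  define T where "T = (\<lambda>z. (p $ i * (snd z - a $ j) - p $ j * (fst z - a $ i)) / D)"
  define U where "U = {z. 0 < S z} \<inter> {z. 0 < T z} \<inter> {z. S z + T z < 1}"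
  have "open U"
    unfolding U_def S_def T_def
    by (intro open_Int open_Collect_less continuous_intros) (use D in auto)
  moreover define z where "z = (a $ i + (p $ i + q $ i) / 3, a $ j + (p $ j + q $ j) / 3)"
  have "S z = 1 / 3" "T z = 1 / 3"
    using D by (auto simp: S_def T_def z_def D_def divide_simps) (auto simp: algebra_simps)
  then have "z \<in> U" by (simp add: U_def)
  ultimately obtain A B where AB: "open A" "open B" "z \<in> A \<times> B" "A \<times> B \<subseteq> U"
    by (rule open_prod_elim)
  have rat: "\<exists>r\<in>\<rat>. r \<in> X" if "open X" "x \<in> X" for X and x :: real
  proof -
    obtain e where e: "0 < e" "ball x e \<subseteq> X"
      using \<open>open X\<close> \<open>x \<in> X\<close> open_contains_ball by blast
    obtain r where "r \<in> \<rat>" "x < r" "r < x + e"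
      using Rats_dense_in_real[of x "x + e"] e by auto
    with e show ?thesis by (intro bexI[of _ r]) (auto simp: dist_real_def subset_iff)
  qed
  obtain x y where xy: "x \<in> \<rat>" "y \<in> \<rat>" "(x, y) \<in> U"
    using rat[OF AB(1), of "fst z"] rat[OF AB(2), of "snd z"] AB(3,4) by (auto simp: mem_Times_iff)
  have ST: "S (x, y) * D = (x - a $ i) * q $ j - (y - a $ j) * q $ i"
      "T (x, y) * D = p $ i * (y - a $ j) - p $ j * (x - a $ i)"
    using D by (simp_all add: S_def T_def)
  have "(S (x, y) * p $ i + T (x, y) * q $ i) * D = S (x, y) * D * p $ i + T (x, y) * D * q $ i"
    by (simp add: algebra_simps)
  also have "\<dots> = (x - a $ i) * D"
    unfolding ST by (simp add: D_def algebra_simps)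
  finally have "a $ i + S (x, y) * p $ i + T (x, y) * q $ i = x"
    using D by simp
  moreover have "(S (x, y) * p $ j + T (x, y) * q $ j) * D = S (x, y) * D * p $ j + T (x, y) * D * q $ j"
    by (simp add: algebra_simps)
  then have "(S (x, y) * p $ j + T (x, y) * q $ j) * D = (y - a $ j) * D"
    unfolding ST by (simp add: D_def algebra_simps)
  then have "a $ j + S (x, y) * p $ j + T (x, y) * q $ j = y"
    using D by simp
  ultimately show ?thesis
    using ij xy by (intro that[of i j "S (x, y)" "T (x, y)"]) (auto simp: U_def)
qed

text \<open>The fibres in question are those of \<open>y \<mapsto> sgn (closest_point K y)\<close>, and a fibre counts as fat if it
  contains a nondegenerate open triangle. This one notion covers both kinds of exceptional directions: those
  with several normals at \<open>radial_map K u\<close>, and those whose ray runs inside the boundary of \<open>K\<close>.\<close>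

definition fat_fibre_directions :: "'a::euclidean_space set \<Rightarrow> 'a set" where
  "fat_fibre_directions K = {u \<in> sphere 0 1. \<exists>a p q. p \<noteq> 0 \<and> (\<forall>c. q \<noteq> c *\<^sub>R p) \<and>
     (\<forall>s>0. \<forall>t>0. s + t < 1 \<longrightarrow> (\<exists>r>0. closest_point K (a + s *\<^sub>R p + t *\<^sub>R q) = r *\<^sub>R u))}"

text \<open>Every fat fibre meets one of the countably many flats of codimension 2 given by two rational
  coordinates, so the fat directions lie in the image of these flats. The flats are null in dimension
  \<open>n - 1\<close>, the metric projection is 1-Lipschitz, and \<^const>\<open>sgn\<close> preserves null sets that avoid the origin.\<close>

lemma hausdorff_null_fat_fibre_directions:
  fixes K :: "(real ^ 'n) set"
  assumes "closed K" "convex K" "K \<noteq> {}"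
  shows "hausdorff_outer_measure (CARD('n) - 1) (fat_fibre_directions K) = 0"
proof -
  define F where "F = (\<lambda>((i, j), x, y). sgn ` (closest_point K ` {z :: real^'n. z $ i = x \<and> z $ j = y} - {0}))"
  define I where "I = {(i :: 'n, j :: 'n). i \<noteq> j} \<times> (\<rat> :: real set) \<times> (\<rat> :: real set)"
  have "countable I"
    unfolding I_def by (intro countable_SIGMA countable_rat) auto
  moreover have "hausdorff_outer_measure (CARD('n) - 1) (F k) = 0" if kI: "k \<in> I" for k
  proof -
    obtain i j x y where k: "k = ((i, j), x, y)" "i \<noteq> j"
      using kI unfolding I_def by (cases k) auto
    define L where "L = {z :: real^'n. z $ i = x \<and> z $ j = y}"
    have "hausdorff_outer_measure (CARD('n) - 1) (closest_point K ` L)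
        \<le> ennreal (1 ^ (CARD('n) - 1)) * hausdorff_outer_measure (CARD('n) - 1) L"
      by (rule hausdorff_outer_measure_lipschitz_image)
         (use closest_point_lipschitz[OF assms(2,1,3)] in auto)
    also have "\<dots> = 0"
      using hausdorff_null_codim2_flat[OF k(2)] by (simp add: L_def)
    finally have "hausdorff_outer_measure (CARD('n) - 1) (closest_point K ` L) = 0"
      by simp
    then have "hausdorff_outer_measure (CARD('n) - 1) (closest_point K ` L - {0}) = 0"
      using hausdorff_outer_measure_mono[of "closest_point K ` L - {0}" "closest_point K ` L" "CARD('n) - 1"]
      by auto
    then show ?thesis
      unfolding F_def k prod.case L_def[symmetric] by (intro hausdorff_null_sgn_image) auto
  qed
  ultimately have "hausdorff_outer_measure (CARD('n) - 1) (\<Union>(F ` I)) = 0"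
    by (intro hausdorff_null_countable_Union) auto
  moreover have "fat_fibre_directions K \<subseteq> \<Union>(F ` I)"
  proof
    fix u assume u: "u \<in> fat_fibre_directions K"
    then obtain a p q where pq: "p \<noteq> 0" "\<And>c. q \<noteq> c *\<^sub>R p"
      and fib: "\<And>s t. 0 < s \<Longrightarrow> 0 < t \<Longrightarrow> s + t < 1 \<Longrightarrow> \<exists>r>0. closest_point K (a + s *\<^sub>R p + t *\<^sub>R q) = r *\<^sub>R u"
      unfolding fat_fibre_directions_def by blast
    obtain i j s t where st: "i \<noteq> j" "0 < s" "0 < t" "s + t < 1"
      and rat: "(a + s *\<^sub>R p + t *\<^sub>R q) $ i \<in> \<rat>" "(a + s *\<^sub>R p + t *\<^sub>R q) $ j \<in> \<rat>"
      using triangle_meets_rational_codim2_flat[OF pq] by blast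
    define z where "z = a + s *\<^sub>R p + t *\<^sub>R q"
    obtain r where r: "0 < r" "closest_point K z = r *\<^sub>R u"
      using fib[OF st(2-4)] unfolding z_def by blast
    have nu: "norm u = 1"
      using u by (simp add: fat_fibre_directions_def)
    have "sgn (closest_point K z) = u"
      using r nu by (simp add: sgn_div_norm)
    moreover have "closest_point K z \<noteq> 0"
      using r nu by auto
    ultimately have "u \<in> F ((i, j), z $ i, z $ j)"
      unfolding F_def prod.case by (intro image_eqI[of _ _ "closest_point K z"]) auto
    moreover have "((i, j), z $ i, z $ j) \<in> I"
      using st rat by (simp add: I_def z_def)
    ultimately show "u \<in> \<Union>(F ` I)" by blast
  qed
  ultimately show ?thesis
    by (rule hausdorff_null_subset[rotated])
qed

section \<open>Radial function and normals of a convex body\<close>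

lemma convex_bodies_oD:
  assumes "K \<in> convex_bodies_o"
  shows "compact K" "convex K" "0 \<in> K" "closed K" "bounded K" "K \<noteq> {}"
  using assms by (auto simp: convex_bodies_o_def compact_imp_closed compact_imp_bounded)

lemma
  fixes K :: "'a::euclidean_space set"
  assumes K: "K \<in> convex_bodies_o" and u: "u \<in> sphere 0 1"
  shows radial_function_nonneg: "0 \<le> radial_function K u"
    and radial_map_mem: "radial_map K u \<in> K"
    and le_radial_function: "0 \<le> s \<Longrightarrow> s *\<^sub>R u \<in> K \<Longrightarrow> s \<le> radial_function K u"
proof -
  note KD = convex_bodies_oD[OF K]
  define R where "R = {l. 0 \<le> l \<and> l *\<^sub>R u \<in> K}"
  have "0 \<in> R" using KD by (simp add: R_def)
  obtain b where b: "\<And>x. x \<in> K \<Longrightarrow> norm x \<le> b"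
    using KD(5) by (auto simp: bounded_iff)
  have "l \<le> b" if "l \<in> R" for l
    using b[of "l *\<^sub>R u"] that u by (simp add: R_def)
  then have bdd: "bdd_above R" by (rule bdd_aboveI)
  have "closed ({0..} \<inter> (\<lambda>l. l *\<^sub>R u) -` K)"
    by (intro closed_Int closed_atLeast continuous_closed_vimage KD continuous_intros)
  moreover have "R = {0..} \<inter> (\<lambda>l. l *\<^sub>R u) -` K" by (auto simp: R_def)
  ultimately have "closed R" by simp
  then have "Sup R \<in> R"
    using closed_contains_Sup[of R] \<open>0 \<in> R\<close> bdd by blast
  then show "0 \<le> radial_function K u" "radial_map K u \<in> K"
    by (auto simp: R_def radial_function_def radial_map_def)
  show "s \<le> radial_function K u" if "0 \<le> s" "s *\<^sub>R u \<in> K"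
    unfolding radial_function_def using that bdd by (intro cSup_upper) (auto simp: R_def)
qed

lemma scaleR_mem_if_le_radial_function:
  fixes K :: "'a::euclidean_space set"
  assumes K: "K \<in> convex_bodies_o" and u: "u \<in> sphere 0 1" and "0 \<le> s" "s \<le> radial_function K u"
  shows "s *\<^sub>R u \<in> K"
proof (cases "s = 0")
  case True
  then show ?thesis using convex_bodies_oD[OF K] by simp
next
  case False
  define r where "r = radial_function K u"
  have "(1 - s / r) *\<^sub>R 0 + (s / r) *\<^sub>R (r *\<^sub>R u) \<in> K"
    using convex_bodies_oD[OF K] radial_map_mem[OF K u] assms False
    by (intro convexD) (auto simp: r_def radial_map_def)
  then show ?thesis using False assms by (simp add: r_def)
qed

lemma mem_normal_cone_iff: "v \<in> normal_cone K x \<longleftrightarrow> (\<forall>y\<in>K. v \<bullet> y \<le> v \<bullet> x)"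
  by (simp add: normal_cone_def inner_diff_right)

lemma normal_cone_interior_less:
  fixes K :: "'a::euclidean_space set"
  assumes "v \<in> normal_cone K x" "v \<in> sphere 0 1" "y \<in> interior K"
  shows "v \<bullet> y < v \<bullet> x"
proof -
  obtain e where e: "0 < e" "cball y e \<subseteq> K"
    using assms(3) mem_interior_cball by blast
  then have "y + e *\<^sub>R v \<in> K"
    using assms(2) by (auto simp: dist_norm)
  then have "v \<bullet> (y + e *\<^sub>R v) \<le> v \<bullet> x"
    using assms(1) by (simp add: mem_normal_cone_iff)
  moreover have "v \<bullet> v = 1" using assms(2) by (simp add: dot_square_norm)
  ultimately show ?thesis using e(1) by (simp add: inner_add_right)
qed

lemma radial_map_in_frontier:
  fixes K :: "'a::euclidean_space set"
  assumes K: "K \<in> convex_bodies_o" and u: "u \<in> sphere 0 1"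
  shows "radial_map K u \<in> frontier K"
proof -
  have "radial_map K u \<notin> interior K"
  proof
    assume "radial_map K u \<in> interior K"
    then obtain e where e: "0 < e" "cball (radial_map K u) e \<subseteq> K"
      using mem_interior_cball by blast
    then have "radial_map K u + e *\<^sub>R u \<in> K"
      using u by (auto simp: dist_norm)
    then have "(radial_function K u + e) *\<^sub>R u \<in> K"
      by (simp add: radial_map_def scaleR_add_left)
    then have "radial_function K u + e \<le> radial_function K u"
      using e(1) radial_function_nonneg[OF K u] by (intro le_radial_function[OF K u]) auto
    with e(1) show False by simp
  qed
  then show ?thesis
    using radial_map_mem[OF K u] closure_subset by (auto simp: frontier_def)
qed

text \<open>A normal at \<open>radial_map K u\<close> is not a normal at the origin exactly if it has positive inner product
  with \<open>radial_map K u\<close>, because that inner product is the value of the support function.\<close>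

lemma mem_dual_curvature_domain_iff:
  fixes K :: "'a::euclidean_space set"
  assumes K: "K \<in> convex_bodies_o"
  shows "u \<in> dual_curvature_domain K E \<longleftrightarrow> u \<in> sphere 0 1 \<and>
    (\<exists>v\<in>E. v \<in> normal_cone K (radial_map K u) \<and> 0 < v \<bullet> radial_map K u)"
proof -
  have "v \<notin> normal_cone K 0 \<longleftrightarrow> 0 < v \<bullet> radial_map K u"
    if "u \<in> sphere 0 1" "v \<in> normal_cone K (radial_map K u)" for v
    using that radial_map_mem[OF K that(1)] by (auto simp: mem_normal_cone_iff not_le intro: less_le_trans)
  then show ?thesis
    using radial_map_in_frontier[OF K, of u]
    by (auto simp: dual_curvature_domain_def reverse_radial_gauss_image_def reverse_spherical_image_def)
qed

lemma unit_normal_exists: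
  fixes K :: "'a::euclidean_space set"
  assumes "convex K" "closed K" "x \<in> K" "x \<notin> interior K"
  obtains v where "v \<in> sphere 0 1" "v \<in> normal_cone K x"
proof -
  have "\<exists>a. a \<noteq> 0 \<and> (\<forall>y\<in>K. a \<bullet> y \<le> a \<bullet> x)"
  proof (cases "interior K = {}")
    case True
    then obtain a b where "a \<noteq> 0" "K \<subseteq> {x. a \<bullet> x = b}"
      using empty_interior_subset_hyperplane[OF \<open>convex K\<close>] by blast
    then have "a \<bullet> y = b" if "y \<in> K" for y using that by blast
    with \<open>x \<in> K\<close> \<open>a \<noteq> 0\<close> show ?thesis by (intro exI[of _ a]) simp
  next
    case False
    obtain a b where ab: "a \<noteq> 0" "\<And>y. y \<in> interior K \<Longrightarrow> a \<bullet> y \<le> b" "b \<le> a \<bullet> x"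
      using separating_hyperplane_sets[of "interior K" "{x}"] False assms by (auto simp: convex_interior)
    have "closure (interior K) \<subseteq> {y. a \<bullet> y \<le> b}"
      by (rule closure_minimal) (auto simp: ab closed_halfspace_le)
    then have "K \<subseteq> {y. a \<bullet> y \<le> b}"
      using convex_closure_interior[OF \<open>convex K\<close> False] \<open>closed K\<close> by simp
    with ab show ?thesis by (intro exI[of _ a]) auto
  qed
  then obtain a where a: "a \<noteq> 0" "\<And>y. y \<in> K \<Longrightarrow> a \<bullet> y \<le> a \<bullet> x" by blast
  then show ?thesis
    by (intro that[of "sgn a"])
       (auto simp: norm_sgn mem_normal_cone_iff sgn_div_norm intro!: divide_right_mono)
qed

lemma closest_point_normal:
  fixes K :: "'a::euclidean_space set"
  assumes "convex K" "closed K" "x \<in> K" "v \<in> normal_cone K x"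
  shows "closest_point K (x + v) = x"
proof -
  have "dist (x + v) x \<le> dist (x + v) z" if "z \<in> K" for z
  proof -
    have "v \<bullet> z \<le> v \<bullet> x" using assms(4) that by (simp add: mem_normal_cone_iff)
    then have "v \<bullet> v \<le> (x + v - z) \<bullet> (x + v - z)"
      using inner_ge_zero[of "x - z"] by (simp add: inner_diff_left inner_diff_right inner_add_left inner_add_right inner_commute)
    then show ?thesis by (simp add: dist_norm norm_le)
  qed
  then show ?thesis using closest_point_unique assms by metis
qed

text \<open>Two different normals at \<open>radial_map K u\<close> span a sector of normals, and the metric projection sends
  the translate of this sector to the single point \<open>radial_map K u\<close>.\<close>

lemma normal_unique_off_fat_fibres:
  fixes K :: "'a::euclidean_space set"
  assumes K: "K \<in> convex_bodies_o" and u: "u \<in> sphere 0 1" "u \<notin> fat_fibre_directions K"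
    and v: "v \<in> sphere 0 1" "v \<in> normal_cone K (radial_map K u)" "0 < v \<bullet> radial_map K u"
    and w: "w \<in> sphere 0 1" "w \<in> normal_cone K (radial_map K u)" "0 < w \<bullet> radial_map K u"
  shows "v = w"
proof (rule ccontr)
  assume "v \<noteq> w"
  note KD = convex_bodies_oD[OF K]
  have "w \<noteq> c *\<^sub>R v" for c
  proof
    assume c: "w = c *\<^sub>R v"
    then have "\<bar>c\<bar> = 1" using v(1) w(1) by simp
    moreover have "0 < c" using c v(3) w(3) by (simp add: zero_less_mult_iff)
    ultimately show False using c \<open>v \<noteq> w\<close> by simp
  qed
  moreover have "\<exists>r>0. closest_point K (radial_map K u + s *\<^sub>R v + t *\<^sub>R w) = r *\<^sub>R u"
    if "0 < s" "0 < t" for s t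
  proof -
    have "s *\<^sub>R v + t *\<^sub>R w \<in> normal_cone K (radial_map K u)"
      using v(2) w(2) that by (auto simp: mem_normal_cone_iff inner_add_left intro!: add_mono mult_left_mono)
    then have "closest_point K (radial_map K u + (s *\<^sub>R v + t *\<^sub>R w)) = radial_map K u"
      using KD radial_map_mem[OF K u(1)] by (intro closest_point_normal)
    moreover have "0 < radial_function K u"
      using v(3) radial_function_nonneg[OF K u(1)] by (auto simp: radial_map_def zero_less_mult_iff)
    ultimately show ?thesis by (intro exI[of _ "radial_function K u"]) (simp add: radial_map_def add.assoc)
  qed
  moreover have "v \<noteq> 0" using v(1) by auto
  ultimately have "u \<in> fat_fibre_directions K"
    using u(1) unfolding fat_fibre_directions_def by blast
  with u(2) show False by simp
qed

text \<open>If the ray misses the interior, then its segment in \<open>K\<close> lies in a supporting hyperplane; the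
  metric projection maps the half strip over this segment in the normal direction onto the segment.\<close>

lemma ray_meets_interior_off_fat_fibres:
  fixes K :: "'a::euclidean_space set"
  assumes K: "K \<in> convex_bodies_o" and u: "u \<in> sphere 0 1" "u \<notin> fat_fibre_directions K"
    and pos: "0 < radial_function K u"
  obtains t where "0 < t" "t *\<^sub>R u \<in> interior K"
proof -
  note KD = convex_bodies_oD[OF K]
  define r where "r = radial_function K u"
  have r: "0 < r" using pos by (simp add: r_def)
  have "(r / 2) *\<^sub>R u \<in> interior K"
  proof (rule ccontr)
    assume "(r / 2) *\<^sub>R u \<notin> interior K"
    moreover have "(r / 2) *\<^sub>R u \<in> K"
      using r by (intro scaleR_mem_if_le_radial_function[OF K u(1)]) (auto simp: r_def)
    ultimately obtain w where w: "w \<in> sphere 0 1" "w \<in> normal_cone K ((r / 2) *\<^sub>R u)"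
      using unit_normal_exists KD by metis
    then have le: "w \<bullet> y \<le> (r / 2) * (w \<bullet> u)" if "y \<in> K" for y
      using that by (simp add: mem_normal_cone_iff)
    have "0 \<le> (r / 2) * (w \<bullet> u)" using le[OF KD(3)] by simp
    moreover have "r * (w \<bullet> u) \<le> (r / 2) * (w \<bullet> u)"
      using le[OF radial_map_mem[OF K u(1)]] by (simp add: radial_map_def r_def)
    ultimately have wu: "w \<bullet> u = 0"
      using r by (auto simp: zero_le_mult_iff mult_le_cancel_right)
    have "w \<noteq> c *\<^sub>R (r *\<^sub>R u)" for c
    proof
      assume "w = c *\<^sub>R (r *\<^sub>R u)"
      moreover have "u \<bullet> u = 1" using u(1) by (simp add: dot_square_norm)
      ultimately have "c * r = 0" using wu by simp
      with \<open>w = c *\<^sub>R (r *\<^sub>R u)\<close> have "w = 0" by (simp add: scaleR_scaleR)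
      with w(1) show False by simp
    qed
    moreover have "\<exists>l>0. closest_point K (0 + s *\<^sub>R (r *\<^sub>R u) + t *\<^sub>R w) = l *\<^sub>R u"
      if "0 < s" "0 < t" "s + t < 1" for s t
    proof -
      have "t *\<^sub>R w \<in> normal_cone K ((s * r) *\<^sub>R u)"
        using le wu that by (auto simp: mem_normal_cone_iff mult_nonneg_nonpos)
      moreover have "s * r \<le> 1 * r" using that r by (intro mult_right_mono) auto
      then have "(s * r) *\<^sub>R u \<in> K"
        using that r by (intro scaleR_mem_if_le_radial_function[OF K u(1)]) (auto simp: r_def)
      ultimately have "closest_point K ((s * r) *\<^sub>R u + t *\<^sub>R w) = (s * r) *\<^sub>R u"
        using KD by (intro closest_point_normal)
      with that r show ?thesis by (intro exI[of _ "s * r"]) simp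
    qed
    moreover have "r *\<^sub>R u \<noteq> 0" using r u(1) by auto
    ultimately have "u \<in> fat_fibre_directions K"
      using u(1) unfolding fat_fibre_directions_def by blast
    with u(2) show False by simp
  qed
  with r show ?thesis by (intro that[of "r / 2"]) auto
qed

lemma normal_inner_radial_map_pos:
  fixes K :: "'a::euclidean_space set"
  assumes K: "K \<in> convex_bodies_o" and u: "u \<in> sphere 0 1"
    and t: "0 < t" "t *\<^sub>R u \<in> interior K"
    and v: "v \<in> sphere 0 1" "v \<in> normal_cone K (radial_map K u)"
  shows "0 < v \<bullet> radial_map K u"
proof -
  have "t *\<^sub>R u \<in> K" using t interior_subset by blast
  then have "t \<le> radial_function K u"
    using t by (intro le_radial_function[OF K u]) auto
  moreover have "t * (v \<bullet> u) < radial_function K u * (v \<bullet> u)"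
    using normal_cone_interior_less[OF v(2,1) t(2)] by (simp add: radial_map_def)
  then have "0 < (radial_function K u - t) * (v \<bullet> u)" by (simp add: algebra_simps)
  ultimately have "0 < v \<bullet> u" by (auto simp: zero_less_mult_iff)
  with \<open>t \<le> _\<close> t(1) show ?thesis by (simp add: radial_map_def)
qed

section \<open>Integration against a difference of finite measures\<close>

lemma nn_integral_add_measure:
  assumes [simp]: "sets P = sets N" "sets Q = sets N"
    and add: "\<And>A. A \<in> sets N \<Longrightarrow> emeasure N A = emeasure P A + emeasure Q A"
    and g: "g \<in> borel_measurable N"
  shows "integral\<^sup>N N g = integral\<^sup>N P g + integral\<^sup>N Q g"
  using g
proof (induction rule: borel_measurable_induct)
  case (cong f g)
  have "space P = space N" "space Q = space N"
    by (rule sets_eq_imp_space_eq, fact)+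
  then have "integral\<^sup>N N f = integral\<^sup>N N g" "integral\<^sup>N P f = integral\<^sup>N P g" "integral\<^sup>N Q f = integral\<^sup>N Q g"
    using cong(3) by (auto intro!: nn_integral_cong)
  with cong(4) show ?case by simp
next
  case (set A)
  then show ?case by (simp add: add)
next
  case (mult u c)
  then show ?case
    by (simp add: nn_integral_cmult measurable_cong_sets[of P N] measurable_cong_sets[of Q N] distrib_left)
next
  case (add u v)
  then show ?case
    by (simp add: nn_integral_add measurable_cong_sets[of P N] measurable_cong_sets[of Q N] ac_simps)
next
  case (seq U)
  have "\<And>i. U i \<in> borel_measurable P" "\<And>i. U i \<in> borel_measurable Q"
    using seq by (simp_all add: measurable_cong_sets[of P N] measurable_cong_sets[of Q N])
  moreover have "incseq (\<lambda>i. integral\<^sup>N P (U i))" "incseq (\<lambda>i. integral\<^sup>N Q (U i))"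
    using \<open>incseq U\<close> by (auto simp: mono_def le_fun_def intro!: nn_integral_mono)
  moreover have "(SUP i. U i) = (\<lambda>x. SUP i. U i x)"
    by (auto simp: fun_eq_iff SUP_apply image_comp)
  moreover have "U i \<in> borel_measurable N" for i by fact
  ultimately have sup: "integral\<^sup>N N (SUP i. U i) = (SUP i. integral\<^sup>N N (U i))"
    "integral\<^sup>N P (SUP i. U i) = (SUP i. integral\<^sup>N P (U i))"
    "integral\<^sup>N Q (SUP i. U i) = (SUP i. integral\<^sup>N Q (U i))"
    using \<open>incseq U\<close> by (simp_all only: nn_integral_monotone_convergence_SUP)
  have "(SUP i. integral\<^sup>N N (U i)) = (SUP i. integral\<^sup>N P (U i) + integral\<^sup>N Q (U i))"
    using seq by simp
  also have "\<dots> = (SUP i. integral\<^sup>N P (U i)) + (SUP i. integral\<^sup>N Q (U i))"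
    by (rule ennreal_SUP_add) fact+
  finally show ?case unfolding sup .
qed

lemma integral_add_measure:
  fixes f :: "'a \<Rightarrow> real"
  assumes sets: "sets P = sets N" "sets Q = sets N"
    and add: "\<And>A. A \<in> sets N \<Longrightarrow> emeasure N A = emeasure P A + emeasure Q A"
    and f: "integrable N f"
  shows "integral\<^sup>L N f = integral\<^sup>L P f + integral\<^sup>L Q f"
proof -
  have [measurable]: "f \<in> borel_measurable N" using f by simp
  then have [measurable]: "f \<in> borel_measurable P" "f \<in> borel_measurable Q"
    by (simp_all only: measurable_cong_sets[OF sets(1) refl] measurable_cong_sets[OF sets(2) refl])
  have nn: "integral\<^sup>N N g = integral\<^sup>N P g + integral\<^sup>N Q g" if "g \<in> borel_measurable N" for g
    by (rule nn_integral_add_measure[OF sets add that])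
  have fin: "(\<integral>\<^sup>+ x. ennreal (norm (f x)) \<partial>N) < top"
    using f by (simp add: integrable_iff_bounded)
  then have intP: "integrable P f" and intQ: "integrable Q f"
    by (auto simp: integrable_iff_bounded nn)
  have lt: "(\<integral>\<^sup>+ x. ennreal (h x) \<partial>R) < top"
    if "integrable R h" for h :: "'a \<Rightarrow> real" and R
  proof -
    have "(\<integral>\<^sup>+ x. ennreal (h x) \<partial>R) \<le> (\<integral>\<^sup>+ x. ennreal (norm (h x)) \<partial>R)"
      by (intro nn_integral_mono ennreal_leI) simp
    then show ?thesis
      using that by (auto simp: integrable_iff_bounded intro: order_le_less_trans)
  qed
  have "(\<integral>\<^sup>+ x. ennreal (f x) \<partial>N) = (\<integral>\<^sup>+ x. ennreal (f x) \<partial>P) + (\<integral>\<^sup>+ x. ennreal (f x) \<partial>Q)"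
    "(\<integral>\<^sup>+ x. ennreal (- f x) \<partial>N) = (\<integral>\<^sup>+ x. ennreal (- f x) \<partial>P) + (\<integral>\<^sup>+ x. ennreal (- f x) \<partial>Q)"
    by (simp_all add: nn)
  moreover have "integrable P (\<lambda>x. - f x)" "integrable Q (\<lambda>x. - f x)"
    using intP intQ by simp_all
  ultimately show ?thesis
    using lt[OF intP] lt[OF intQ] lt[of P "\<lambda>x. - f x"] lt[of Q "\<lambda>x. - f x"]
    by (simp add: real_lebesgue_integral_def[OF f] real_lebesgue_integral_def[OF intP]
        real_lebesgue_integral_def[OF intQ] enn2real_plus)
qed

text \<open>On a Hahn set \<open>Y\<close> of \<open>M1 - M2\<close> the supremum that defines the positive variation of \<open>A\<close> is attained
  at \<open>A \<inter> Y\<close>.\<close>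

lemma integral_positive_variation:
  fixes f :: "'a \<Rightarrow> real"
  assumes "finite_measure M1" "finite_measure M2"
    and sets[simp]: "sets M1 = sets M" "sets M2 = sets M"
    and \<mu>: "\<And>A. A \<in> sets M \<Longrightarrow> \<mu> A = measure M1 A - measure M2 A"
    and Y: "Y \<in> sets M"
    and ge: "\<And>X. X \<in> sets M \<Longrightarrow> X \<subseteq> Y \<Longrightarrow> emeasure M2 X \<le> emeasure M1 X"
    and le: "\<And>X. X \<in> sets M \<Longrightarrow> X \<inter> Y = {} \<Longrightarrow> emeasure M1 X \<le> emeasure M2 X"
    and f: "f \<in> borel_measurable M" and B: "\<And>x. x \<in> space M \<Longrightarrow> \<bar>f x\<bar> \<le> B"
  shows "integral\<^sup>L (positive_variation M \<mu>) f
    = (\<integral>x. indicator Y x * f x \<partial>M1) - (\<integral>x. indicator Y x * f x \<partial>M2)"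
proof -
  interpret M1: finite_measure M1 by fact
  interpret M2: finite_measure M2 by fact
  have space[simp]: "space M1 = space M" "space M2 = space M"
    by (rule sets_eq_imp_space_eq, fact)+
  define \<nu> where "\<nu> A = ennreal (measure M1 (A \<inter> Y) - measure M2 (A \<inter> Y))" for A
  have nonneg: "0 \<le> measure M1 (A \<inter> Y) - measure M2 (A \<inter> Y)" if "A \<in> sets M" for A
    using ge[of "A \<inter> Y"] that Y by (simp add: M1.emeasure_eq_measure M2.emeasure_eq_measure)
  have \<nu>: "(SUP B \<in> {B \<in> sets M. B \<subseteq> A}. ennreal (\<mu> B)) = \<nu> A" if A: "A \<in> sets M" for A
  proof (rule antisym)
    show "\<nu> A \<le> (SUP B \<in> {B \<in> sets M. B \<subseteq> A}. ennreal (\<mu> B))"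
      using A Y by (intro SUP_upper2[of "A \<inter> Y"]) (auto simp: \<nu>_def \<mu>)
    show "(SUP B \<in> {B \<in> sets M. B \<subseteq> A}. ennreal (\<mu> B)) \<le> \<nu> A"
    proof (rule SUP_least)
      fix B assume "B \<in> {B \<in> sets M. B \<subseteq> A}"
      then have B: "B \<in> sets M" "B \<subseteq> A" by auto
      have "measure N B = measure N (B \<inter> Y) + measure N (B - Y)"
        if "finite_measure N" "sets N = sets M" for N
        using finite_measure.finite_measure_Union[OF that(1), of "B \<inter> Y" "B - Y"] that(2) B Y
        by (simp add: Int_Diff_Un Int_Diff_disjoint)
      then have 1: "measure M1 B = measure M1 (B \<inter> Y) + measure M1 (B - Y)"
        "measure M2 B = measure M2 (B \<inter> Y) + measure M2 (B - Y)"
        using assms(1,2) sets by blast+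
      have AY: "measure N (A \<inter> Y) = measure N (B \<inter> Y) + measure N ((A - B) \<inter> Y)"
        if "finite_measure N" "sets N = sets M" for N
      proof -
        have "A \<inter> Y = (B \<inter> Y) \<union> ((A - B) \<inter> Y)" using B by auto
        then show ?thesis
          using finite_measure.finite_measure_Union[OF that(1), of "B \<inter> Y" "(A - B) \<inter> Y"] that(2) A B Y
          by auto
      qed
      have 2: "measure M1 (A \<inter> Y) = measure M1 (B \<inter> Y) + measure M1 ((A - B) \<inter> Y)"
        "measure M2 (A \<inter> Y) = measure M2 (B \<inter> Y) + measure M2 ((A - B) \<inter> Y)"
        using AY assms(1,2) sets by blast+
      have "measure M1 (B - Y) \<le> measure M2 (B - Y)"
        using le[of "B - Y"] B Y by (auto simp: M1.emeasure_eq_measure M2.emeasure_eq_measure)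
      then have "\<mu> B \<le> measure M1 (A \<inter> Y) - measure M2 (A \<inter> Y)"
        using 1 2 nonneg[of "A - B"] A B by (simp add: \<mu>)
      then show "ennreal (\<mu> B) \<le> \<nu> A" unfolding \<nu>_def by (rule ennreal_leI)
    qed
  qed
  define P where "P = positive_variation M \<mu>"
  have P_eq: "P = measure_of (space M) (sets M) \<nu>"
    unfolding P_def positive_variation_def
    by (rule measure_of_eq) (auto simp: \<nu> sets.space_closed sets.sigma_sets_eq)
  have setsP: "sets P = sets M" by (simp add: P_eq)
  have emP: "emeasure P A = \<nu> A" if "A \<in> sets M" for A
  proof (rule emeasure_measure_of[OF P_eq])
    show "countably_additive (sets P) \<nu>"
    proof (rule countably_additiveI)
      fix A :: "nat \<Rightarrow> 'a set" assume A: "range A \<subseteq> sets P" "disjoint_family A"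
      have A': "range (\<lambda>i. A i \<inter> Y) \<subseteq> sets M" "disjoint_family (\<lambda>i. A i \<inter> Y)" "\<And>i. A i \<in> sets M"
        using A Y setsP by (auto simp: disjoint_family_on_def)
      have "(\<lambda>i. measure M1 (A i \<inter> Y) - measure M2 (A i \<inter> Y)) sums
          (measure M1 (\<Union>i. A i \<inter> Y) - measure M2 (\<Union>i. A i \<inter> Y))"
        using A' by (intro sums_diff M1.finite_measure_UNION M2.finite_measure_UNION) auto
      then show "(\<Sum>i. \<nu> (A i)) = \<nu> (\<Union>i. A i)"
        unfolding \<nu>_def using nonneg A'(3) by (subst suminf_ennreal_eq) auto
    qed
  qed (use that setsP sets.space_closed in \<open>auto simp: positive_def \<nu>_def\<close>)
  define N1 where "N1 = density M1 (indicator Y)"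
  define N2 where "N2 = density M2 (indicator Y)"
  have em_density: "emeasure (density N (indicator Y)) A = emeasure N (A \<inter> Y)"
    if "sets N = sets M" "A \<in> sets M" for N A
  proof -
    have "emeasure (density N (indicator Y)) A = (\<integral>\<^sup>+ x. indicator Y x * indicator A x \<partial>N)"
      using that Y by (intro emeasure_density) auto
    also have "\<dots> = (\<integral>\<^sup>+ x. indicator (A \<inter> Y) x \<partial>N)"
      by (intro nn_integral_cong) (auto split: split_indicator)
    also have "\<dots> = emeasure N (A \<inter> Y)"
      using that Y by simp
    finally show ?thesis .
  qed
  have em: "emeasure N1 A = emeasure M1 (A \<inter> Y)" "emeasure N2 A = emeasure M2 (A \<inter> Y)"
    if "A \<in> sets M" for A
    using that by (simp_all add: N1_def N2_def em_density)
  have int: "(\<integral>x. g x \<partial>density N (indicator Y)) = (\<integral>x. indicator Y x * g x \<partial>N)"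
    if "sets N = sets M" "g \<in> borel_measurable M" for N and g :: "'a \<Rightarrow> real"
  proof -
    have "g \<in> borel_measurable N" "Y \<in> sets N"
      using that Y by (simp_all add: measurable_cong_sets[OF that(1) refl])
    moreover have "(indicator Y :: 'a \<Rightarrow> ennreal) = (\<lambda>x. ennreal (indicator Y x))"
      by (auto simp: indicator_def)
    ultimately show ?thesis by (simp add: integral_density)
  qed
  have "integral\<^sup>L N1 f = integral\<^sup>L P f + integral\<^sup>L N2 f"
  proof (rule integral_add_measure)
    show "emeasure N1 A = emeasure P A + emeasure N2 A" if "A \<in> sets N1" for A
    proof -
      have A: "A \<in> sets M" using that by (simp add: N1_def)
      then show ?thesis
        using nonneg[OF A] by (simp add: em emP \<nu>_def M1.emeasure_eq_measure M2.emeasure_eq_measure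
            flip: ennreal_plus)
    qed
    have "finite_measure N1"
      by (rule finite_measureI) (use Y in \<open>simp add: em N1_def[symmetric] space_density[of M1 "indicator Y", folded N1_def] M1.emeasure_eq_measure\<close>)
    then show "integrable N1 f"
      by (rule finite_measure.integrable_const_bound[where B = B])
         (use f B in \<open>auto simp: N1_def measurable_cong_sets[OF sets(1) refl]\<close>)
  qed (auto simp: setsP N1_def N2_def)
  then show ?thesis
    using f by (simp add: int N1_def N2_def P_def)
qed

text \<open>Any representation as a difference of finite measures may replace the Jordan decomposition, since
  the complement of a Hahn set of \<open>M1 - M2\<close> is a Hahn set of \<open>M2 - M1\<close>.\<close>

lemma signed_integral_diff:
  fixes f :: "'a \<Rightarrow> real"
  assumes fin: "finite_measure M1" "finite_measure M2"
    and sets: "sets M1 = sets M" "sets M2 = sets M"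
    and \<mu>: "\<And>A. A \<in> sets M \<Longrightarrow> \<mu> A = measure M1 A - measure M2 A"
    and f: "f \<in> borel_measurable M" and B: "\<And>x. x \<in> space M \<Longrightarrow> \<bar>f x\<bar> \<le> B"
  shows "signed_integral M \<mu> f = integral\<^sup>L M1 f - integral\<^sup>L M2 f"
proof -
  obtain Y where Y: "Y \<in> sets M1" "\<And>X. X \<in> sets M1 \<Longrightarrow> X \<subseteq> Y \<Longrightarrow> emeasure M2 X \<le> emeasure M1 X"
    "\<And>X. X \<in> sets M1 \<Longrightarrow> X \<inter> Y = {} \<Longrightarrow> emeasure M1 X \<le> emeasure M2 X"
    using finite_unsigned_Hahn_decomposition[OF fin] sets by auto
  note Y' = Y[unfolded sets(1)]
  have space: "space M1 = space M" "space M2 = space M"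
    by (rule sets_eq_imp_space_eq, fact)+
  have 1: "integral\<^sup>L (positive_variation M \<mu>) f
    = (\<integral>x. indicator Y x * f x \<partial>M1) - (\<integral>x. indicator Y x * f x \<partial>M2)"
    by (rule integral_positive_variation[OF fin sets \<mu> Y'(1) Y'(2) Y'(3) f B])
  have 2: "integral\<^sup>L (positive_variation M (\<lambda>A. - \<mu> A)) f
    = (\<integral>x. indicator (space M - Y) x * f x \<partial>M2) - (\<integral>x. indicator (space M - Y) x * f x \<partial>M1)"
  proof (rule integral_positive_variation[OF fin(2,1) sets(2,1) _ _ _ _ f B])
    show "emeasure M2 X \<le> emeasure M1 X" if "X \<in> sets M" "X \<inter> (space M - Y) = {}" for X
      using that Y'(2)[of X] sets.sets_into_space[of X M] by blast
    show "emeasure M1 X \<le> emeasure M2 X" if "X \<in> sets M" "X \<subseteq> space M - Y" for X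
      using that Y'(3)[of X] by blast
  qed (use \<mu> Y'(1) in auto)
  have split: "(\<integral>x. f x \<partial>N) = (\<integral>x. indicator Y x * f x \<partial>N) + (\<integral>x. indicator (space M - Y) x * f x \<partial>N)"
    if N: "finite_measure N" "sets N = sets M" for N
  proof -
    have sp: "space N = space M" by (rule sets_eq_imp_space_eq, fact)
    have fN: "integrable N f"
      by (rule finite_measure.integrable_const_bound[OF N(1), where B = B])
         (use f B sp in \<open>auto simp: measurable_cong_sets[OF N(2) refl]\<close>)
    have "(\<integral>x. f x \<partial>N) = (\<integral>x. indicator Y x * f x + indicator (space M - Y) x * f x \<partial>N)"
      by (rule Bochner_Integration.integral_cong) (auto simp: sp indicator_def)
    also have "\<dots> = (\<integral>x. indicator Y x * f x \<partial>N) + (\<integral>x. indicator (space M - Y) x * f x \<partial>N)"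
      using integrable_mult_indicator[OF _ fN, of Y] integrable_mult_indicator[OF _ fN, of "space M - Y"] N(2) Y'(1)
      by (intro Bochner_Integration.integral_add) auto
    finally show ?thesis .
  qed
  show ?thesis
    unfolding signed_integral_def 1 2 split[OF fin(1) sets(1)] split[OF fin(2) sets(2)] by simp
qed

section \<open>The dual curvature measure as a push-forward under the radial Gauss map\<close>

text \<open>The choice is unique off \<^const>\<open>fat_fibre_directions\<close>.\<close>

definition radial_gauss_map :: "'a::euclidean_space set \<Rightarrow> 'a \<Rightarrow> 'a" where
  "radial_gauss_map K u = (SOME v. v \<in> sphere 0 1 \<and> v \<in> normal_cone K (radial_map K u) \<and> 0 < v \<bullet> radial_map K u)"

text \<open>Discarding the zeros of the integrand makes this set, and all its intersections with the sets
  \<open>dual_curvature_domain K E\<close>, measurable as soon as the integrand is integrable over the latter sets.\<close>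

definition curvature_carrier :: "(real \<Rightarrow> 'a::euclidean_space \<Rightarrow> real) \<Rightarrow> 'a set \<Rightarrow> 'a set" where
  "curvature_carrier G K =
     {u \<in> dual_curvature_domain K (sphere 0 1) - fat_fibre_directions K. dual_curvature_integrand G K u \<noteq> 0}"

lemma radial_gauss_map:
  fixes K :: "'a::euclidean_space set"
  assumes K: "K \<in> convex_bodies_o" and u: "u \<in> dual_curvature_domain K (sphere 0 1)"
  shows "radial_gauss_map K u \<in> sphere 0 1" "radial_gauss_map K u \<in> normal_cone K (radial_map K u)"
    "0 < radial_gauss_map K u \<bullet> radial_map K u"
proof -
  obtain v where "v \<in> sphere 0 1 \<and> v \<in> normal_cone K (radial_map K u) \<and> 0 < v \<bullet> radial_map K u"
    using u by (auto simp: mem_dual_curvature_domain_iff[OF K])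
  then have "radial_gauss_map K u \<in> sphere 0 1 \<and> radial_gauss_map K u \<in> normal_cone K (radial_map K u) \<and>
      0 < radial_gauss_map K u \<bullet> radial_map K u"
    unfolding radial_gauss_map_def by (rule someI)
  then show "radial_gauss_map K u \<in> sphere 0 1" "radial_gauss_map K u \<in> normal_cone K (radial_map K u)"
    "0 < radial_gauss_map K u \<bullet> radial_map K u" by auto
qed

text \<open>Uniqueness of the normal turns the existential condition of the domain into a preimage condition,
  so the domains of disjoint sets are disjoint up to fat directions.\<close>

lemma mem_dual_curvature_domain_iff_gauss:
  fixes K :: "'a::euclidean_space set"
  assumes K: "K \<in> convex_bodies_o" and E: "E \<subseteq> sphere 0 1" and u: "u \<notin> fat_fibre_directions K"
  shows "u \<in> dual_curvature_domain K E \<longleftrightarrow>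
     u \<in> dual_curvature_domain K (sphere 0 1) \<and> radial_gauss_map K u \<in> E"
proof
  assume "u \<in> dual_curvature_domain K E"
  then obtain v where v: "u \<in> sphere 0 1" "v \<in> E" "v \<in> normal_cone K (radial_map K u)" "0 < v \<bullet> radial_map K u"
    by (auto simp: mem_dual_curvature_domain_iff[OF K])
  then have dom: "u \<in> dual_curvature_domain K (sphere 0 1)"
    using E by (auto simp: mem_dual_curvature_domain_iff[OF K])
  have "radial_gauss_map K u = v"
    by (rule normal_unique_off_fat_fibres[OF K v(1) u radial_gauss_map[OF K dom]]) (use v E in auto)
  with v dom show "u \<in> dual_curvature_domain K (sphere 0 1) \<and> radial_gauss_map K u \<in> E" by simp
next
  assume *: "u \<in> dual_curvature_domain K (sphere 0 1) \<and> radial_gauss_map K u \<in> E"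
  then show "u \<in> dual_curvature_domain K E"
    using radial_gauss_map[OF K, of u] by (auto simp: mem_dual_curvature_domain_iff[OF K])
qed

text \<open>The value \<open>e\<close> off the carrier only makes the map total and measurable.\<close>

definition carrier_gauss_map :: "(real \<Rightarrow> 'a::euclidean_space \<Rightarrow> real) \<Rightarrow> 'a set \<Rightarrow> 'a \<Rightarrow> 'a \<Rightarrow> 'a" where
  "carrier_gauss_map G K e u = (if u \<in> curvature_carrier G K then radial_gauss_map K u else e)"

definition carrier_density :: "(real \<Rightarrow> 'a::euclidean_space \<Rightarrow> real) \<Rightarrow> 'a set \<Rightarrow> 'a \<Rightarrow> real" where
  "carrier_density G K u = indicator (curvature_carrier G K) u * dual_curvature_integrand G K u"

lemma space_sphere_borel [simp]: "space sphere_borel = sphere 0 1"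
  by (simp add: sphere_borel_def space_restrict_space)

lemma sets_sphere_borel_subset: "E \<in> sets sphere_borel \<Longrightarrow> E \<subseteq> sphere 0 1"
  using sets.sets_into_space[of E sphere_borel] by simp

lemma
  fixes K :: "'a::euclidean_space set"
  assumes K: "K \<in> convex_bodies_o"
    and null: "hausdorff_outer_measure (DIM('a) - 1) (fat_fibre_directions K) = 0"
    and int: "\<And>E. E \<in> sets sphere_borel \<Longrightarrow> dual_curvature_integrable G K E"
    and e: "e \<in> sphere 0 1"
  defines "H \<equiv> hausdorff_measure (DIM('a) - 1) :: 'a measure"
  shows curvature_carrier_sets: "curvature_carrier G K \<in> sets H"
    and measurable_carrier_gauss_map: "carrier_gauss_map G K e \<in> measurable H sphere_borel"
    and integrable_carrier_density: "integrable H (carrier_density G K)"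
    and dual_curvature_measure_eq: "E \<in> sets sphere_borel \<Longrightarrow> dual_curvature_measure G K E =
        1 / real DIM('a) * (\<integral>u. carrier_density G K u * indicator E (carrier_gauss_map G K e u) \<partial>H)"
proof -
  have spH: "space H = UNIV" by (simp add: H_def space_hausdorff_measure)
  define T where "T = fat_fibre_directions K"
  have T: "T \<in> null_sets H"
    unfolding H_def T_def by (rule hausdorff_null_in_null_sets[OF null])
  define g where "g = dual_curvature_integrand G K"
  define W where "W = curvature_carrier G K"
  have gint: "integrable H (\<lambda>u. indicator (dual_curvature_domain K E) u * g u)" if "E \<in> sets sphere_borel" for E
    using int[OF that] by (simp add: dual_curvature_integrable_def set_integrable_def H_def g_def)
  have dom: "u \<in> dual_curvature_domain K E \<longleftrightarrow>
      u \<in> dual_curvature_domain K (sphere 0 1) \<and> radial_gauss_map K u \<in> E"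
    if "E \<in> sets sphere_borel" "u \<notin> T" for E u
    using mem_dual_curvature_domain_iff_gauss[OF K sets_sphere_borel_subset] that by (simp add: T_def)
  \<comment> \<open>Nonvanishing of the integrable product cuts \<open>dual_curvature_domain K E\<close> down to a measurable set.\<close>
  have W_dom: "{u \<in> W. radial_gauss_map K u \<in> E} \<in> sets H" if E: "E \<in> sets sphere_borel" for E
  proof -
    have "{u \<in> space H. indicator (dual_curvature_domain K E) u * g u \<noteq> 0} - T \<in> sets H"
      using borel_measurable_integrable[OF gint[OF E]] T
      by (intro sets.Diff borel_measurable_neq null_setsD2) auto
    moreover have "{u \<in> space H. indicator (dual_curvature_domain K E) u * g u \<noteq> 0} - T
        = {u \<in> W. radial_gauss_map K u \<in> E}"
      using dom[OF E] by (auto simp: W_def curvature_carrier_def T_def g_def spH indicator_def)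
    ultimately show ?thesis by simp
  qed
  have sph: "sphere 0 1 \<in> sets (sphere_borel :: 'a measure)"
    using sets.top[of "sphere_borel :: 'a measure"] by simp
  have W_gauss: "radial_gauss_map K u \<in> sphere 0 1" if "u \<in> W" for u
    using that by (intro radial_gauss_map[OF K]) (auto simp: W_def curvature_carrier_def)
  have "{u \<in> W. radial_gauss_map K u \<in> sphere 0 1} = W"
    using W_gauss by blast
  then show W: "curvature_carrier G K \<in> sets H"
    using W_dom[OF sph] by (simp add: W_def)
  show "carrier_gauss_map G K e \<in> measurable H sphere_borel"
  proof (rule measurableI)
    show "carrier_gauss_map G K e u \<in> space sphere_borel" for u
      using W_gauss[of u] e by (auto simp: carrier_gauss_map_def W_def)
    fix E :: "'a set" assume E: "E \<in> sets sphere_borel"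
    have "carrier_gauss_map G K e -` E \<inter> space H
        = {u \<in> W. radial_gauss_map K u \<in> E} \<union> (if e \<in> E then space H - W else {})"
      by (auto simp: carrier_gauss_map_def W_def spH split: if_splits)
    then show "carrier_gauss_map G K e -` E \<inter> space H \<in> sets H"
      using W_dom[OF E] W by (auto simp: W_def)
  qed
  have ae: "AE u in H. indicator (dual_curvature_domain K E) u * g u
      = carrier_density G K u * indicator E (carrier_gauss_map G K e u)" if E: "E \<in> sets sphere_borel" for E
    using AE_not_in[OF T]
  proof eventually_elim
    case (elim u)
    then show ?case
      using dom[OF E, of u]
      by (auto simp: carrier_density_def carrier_gauss_map_def curvature_carrier_def T_def g_def indicator_def)
  qed
  have Wint: "carrier_density G K u = indicator W u * (indicator (dual_curvature_domain K (sphere 0 1)) u * g u)" for u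
    by (auto simp: carrier_density_def W_def curvature_carrier_def g_def indicator_def)
  show di: "integrable H (carrier_density G K)"
    unfolding Wint using gint[OF sph] W
    by (subst mult.commute) (rule integrable_real_mult_indicator, auto simp: W_def)
  show "dual_curvature_measure G K E =
        1 / real DIM('a) * (\<integral>u. carrier_density G K u * indicator E (carrier_gauss_map G K e u) \<partial>H)"
    if E: "E \<in> sets sphere_borel"
  proof -
    have "carrier_gauss_map G K e \<in> measurable H sphere_borel" by fact
    then have "(\<lambda>u. indicator E (carrier_gauss_map G K e u) :: real) \<in> borel_measurable H"
      using E by (intro measurable_compose[OF _ borel_measurable_indicator])
    then have "(\<integral>u. indicator (dual_curvature_domain K E) u * g u \<partial>H)
        = (\<integral>u. carrier_density G K u * indicator E (carrier_gauss_map G K e u) \<partial>H)"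
      using ae[OF E] di gint[OF E] by (intro integral_cong_AE) auto
    then show ?thesis
      by (simp add: dual_curvature_measure_def set_lebesgue_integral_def H_def g_def)
  qed
qed

text \<open>The two measures are, up to the factor \<open>1 / n\<close>, the push-forwards of the positive and the negative part of the density.\<close>

lemma dual_curvature_measure_decomposition:
  fixes K :: "'a::euclidean_space set"
  assumes K: "K \<in> convex_bodies_o"
    and null: "hausdorff_outer_measure (DIM('a) - 1) (fat_fibre_directions K) = 0"
    and int: "\<And>E. E \<in> sets sphere_borel \<Longrightarrow> dual_curvature_integrable G K E"
    and e: "e \<in> sphere 0 1"
  obtains M1 M2 where "finite_measure M1" "finite_measure M2"
    "sets M1 = sets sphere_borel" "sets M2 = sets sphere_borel"
    "\<And>E. E \<in> sets sphere_borel \<Longrightarrow> dual_curvature_measure G K E = measure M1 E - measure M2 E"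
    "\<And>f B. f \<in> borel_measurable sphere_borel \<Longrightarrow> (\<And>v. v \<in> sphere 0 1 \<Longrightarrow> \<bar>f v\<bar> \<le> B) \<Longrightarrow>
       integral\<^sup>L M1 f - integral\<^sup>L M2 f = 1 / real DIM('a) *
         (\<integral>u. carrier_density G K u * f (carrier_gauss_map G K e u) \<partial>hausdorff_measure (DIM('a) - 1))"
proof -
  define H where "H = (hausdorff_measure (DIM('a) - 1) :: 'a measure)"
  define n where "n = real DIM('a)"
  have n: "0 < n" by (simp add: n_def)
  define d where "d = carrier_density G K"
  define \<alpha> where "\<alpha> = carrier_gauss_map G K e"
  have \<alpha>[measurable]: "\<alpha> \<in> measurable H sphere_borel"
    using measurable_carrier_gauss_map[OF K null int e] by (simp add: \<alpha>_def H_def)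
  have d: "integrable H d"
    using integrable_carrier_density[OF K null int e] by (simp add: d_def H_def)
  then have [measurable]: "d \<in> borel_measurable H" by simp
  define M where "M s = distr (density H (\<lambda>u. ennreal (max 0 (s * d u / n)))) sphere_borel \<alpha>" for s :: real
  have setsM: "sets (M s) = sets sphere_borel" for s by (simp add: M_def)
  have intM: "integral\<^sup>L (M s) f = (\<integral>u. max 0 (s * d u / n) * f (\<alpha> u) \<partial>H)"
    if [measurable]: "f \<in> borel_measurable sphere_borel" for f :: "'a \<Rightarrow> real" and s
    unfolding M_def by (simp add: integral_distr integral_density)
  have dmax: "integrable H (\<lambda>u. max 0 (s * d u / n))" for s
    using d by (intro integrable_max) auto
  have finM: "finite_measure (M s)" for s
  proof -
    let ?D = "density H (\<lambda>u. ennreal (max 0 (s * d u / n)))"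
    have "emeasure ?D (space ?D) = (\<integral>\<^sup>+ u. ennreal (max 0 (s * d u / n)) * indicator (space H) u \<partial>H)"
      unfolding space_density by (rule emeasure_density) auto
    also have "\<dots> = (\<integral>\<^sup>+ u. ennreal (norm (max 0 (s * d u / n))) \<partial>H)"
      by (rule nn_integral_cong) simp
    also have "\<dots> \<noteq> \<infinity>"
      using dmax[of s] by (simp add: integrable_iff_bounded)
    finally have "finite_measure ?D" by (rule finite_measureI)
    moreover have "\<alpha> \<in> measurable ?D sphere_borel" by simp
    ultimately show ?thesis
      unfolding M_def by (rule finite_measure.finite_measure_distr)
  qed
  have diff: "integral\<^sup>L (M 1) f - integral\<^sup>L (M (- 1)) f = 1 / n * (\<integral>u. d u * f (\<alpha> u) \<partial>H)"
    if f[measurable]: "f \<in> borel_measurable sphere_borel" and B: "\<And>v. v \<in> sphere 0 1 \<Longrightarrow> \<bar>f v\<bar> \<le> B"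
    for f :: "'a \<Rightarrow> real" and B
  proof -
    have int: "integrable H (\<lambda>u. max 0 (s * d u / n) * f (\<alpha> u))" for s
    proof (rule Bochner_Integration.integrable_bound)
      show "integrable H (\<lambda>u. B * max 0 (s * d u / n))" using dmax by simp
      have "\<bar>f (\<alpha> u)\<bar> \<le> \<bar>B\<bar>" for u
      proof -
        have "\<alpha> u \<in> sphere 0 1"
          using measurable_space[OF \<alpha>, of u] by (simp add: H_def space_hausdorff_measure)
        then show ?thesis using B by fastforce
      qed
      then have "\<bar>f (\<alpha> u)\<bar> * max 0 (s * d u / n) \<le> \<bar>B\<bar> * max 0 (s * d u / n)" for u
        by (intro mult_right_mono) auto
      then show "AE u in H. norm (max 0 (s * d u / n) * f (\<alpha> u)) \<le> norm (B * max 0 (s * d u / n))"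
        by (auto simp: abs_mult mult.commute)
    qed measurable
    have "integral\<^sup>L (M 1) f - integral\<^sup>L (M (- 1)) f
        = (\<integral>u. max 0 (1 * d u / n) * f (\<alpha> u) - max 0 (- 1 * d u / n) * f (\<alpha> u) \<partial>H)"
      unfolding intM[OF f] by (rule Bochner_Integration.integral_diff[symmetric]) (rule int)+
    also have "\<dots> = (\<integral>u. 1 / n * (d u * f (\<alpha> u)) \<partial>H)"
      using n by (intro Bochner_Integration.integral_cong) (auto simp: max_def field_simps)
    finally show ?thesis by simp
  qed
  have meas: "dual_curvature_measure G K E = measure (M 1) E - measure (M (- 1)) E"
    if E: "E \<in> sets sphere_borel" for E
  proof -
    have m: "measure (M s) E = integral\<^sup>L (M s) (indicator E)" for s
      using E sets.sets_into_space[OF E] by (simp add: M_def Int_absorb2)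
    have "measure (M 1) E - measure (M (- 1)) E = 1 / n * (\<integral>u. d u * indicator E (\<alpha> u) \<partial>H)"
      unfolding m using E by (intro diff[of _ 1]) (auto simp: indicator_def)
    then show ?thesis
      using dual_curvature_measure_eq[OF K null int e E] by (simp add: d_def \<alpha>_def H_def n_def)
  qed
  show ?thesis
    by (rule that[OF finM finM setsM setsM meas])
       (use diff in \<open>auto simp: d_def \<alpha>_def H_def n_def\<close>)
qed

section \<open>Hausdorff convergence of convex bodies\<close>

lemma
  fixes K :: "'a::euclidean_space set"
  assumes K: "K \<in> convex_bodies_o"
  shows inner_le_support_function: "x \<in> K \<Longrightarrow> v \<bullet> x \<le> support_function K v"
    and support_function_le: "(\<And>x. x \<in> K \<Longrightarrow> v \<bullet> x \<le> c) \<Longrightarrow> support_function K v \<le> c"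
proof -
  note KD = convex_bodies_oD[OF K]
  have "bounded ((\<bullet>) v ` K)"
    using KD(1) by (intro compact_imp_bounded compact_continuous_image continuous_intros)
  then have bdd: "bdd_above ((\<bullet>) v ` K)" by (rule bounded_imp_bdd_above)
  show "x \<in> K \<Longrightarrow> v \<bullet> x \<le> support_function K v"
    unfolding support_function_def by (rule cSUP_upper[OF _ bdd])
  show "(\<And>x. x \<in> K \<Longrightarrow> v \<bullet> x \<le> c) \<Longrightarrow> support_function K v \<le> c"
    unfolding support_function_def using KD(6) by (rule cSUP_least)
qed

lemma support_function_bounded:
  fixes K :: "'a::euclidean_space set"
  assumes K: "K \<in> convex_bodies_o"
  obtains b where "\<And>v. v \<in> sphere 0 1 \<Longrightarrow> \<bar>support_function K v\<bar> \<le> b"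
proof -
  note KD = convex_bodies_oD[OF K]
  obtain b where b: "\<And>x. x \<in> K \<Longrightarrow> norm x \<le> b"
    using KD(5) by (auto simp: bounded_iff)
  have "\<bar>support_function K v\<bar> \<le> b" if "v \<in> sphere 0 1" for v
  proof -
    have "support_function K v \<le> b"
    proof (rule support_function_le[OF K])
      fix x assume "x \<in> K"
      then show "v \<bullet> x \<le> b"
        using norm_cauchy_schwarz[of v x] b[of x] that by simp
    qed
    moreover have "0 \<le> support_function K v"
      using inner_le_support_function[OF K KD(3), of v] by simp
    ultimately show ?thesis by simp
  qed
  then show ?thesis by (rule that)
qed

lemma support_function_diff_le_hausdorff_distance:
  fixes K L :: "'a::euclidean_space set"
  assumes K: "K \<in> convex_bodies_o" and L: "L \<in> convex_bodies_o" and v: "v \<in> sphere 0 1"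
  shows "\<bar>support_function L v - support_function K v\<bar> \<le> hausdorff_distance L K"
proof -
  obtain b where b: "\<And>v. v \<in> sphere 0 1 \<Longrightarrow> \<bar>support_function K v\<bar> \<le> b"
    using support_function_bounded[OF K] by blast
  obtain c where c: "\<And>v. v \<in> sphere 0 1 \<Longrightarrow> \<bar>support_function L v\<bar> \<le> c"
    using support_function_bounded[OF L] by blast
  have "bdd_above ((\<lambda>v. \<bar>support_function L v - support_function K v\<bar>) ` sphere 0 1)"
    by (rule bdd_aboveI2[where M = "b + c"]) (use b c in fastforce)
  then show ?thesis
    unfolding hausdorff_distance_def using v by (intro cSUP_upper)
qed

lemma separating_unit_vector:
  fixes L :: "'a::euclidean_space set"
  assumes L: "L \<in> convex_bodies_o" and x: "x \<notin> L"
  obtains v where "v \<in> sphere 0 1" "support_function L v < v \<bullet> x"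
proof -
  note LD = convex_bodies_oD[OF L]
  obtain a b where ab: "a \<bullet> x < b" "\<forall>y\<in>L. a \<bullet> y > b"
    using separating_hyperplane_closed_point[OF LD(2,4) x] by blast
  have b0: "b < 0" using ab(2) LD(3) by force
  with ab have "a \<noteq> 0" by auto
  define v where "v = - a /\<^sub>R norm a"
  have "support_function L v \<le> - b / norm a"
  proof (rule support_function_le[OF L])
    fix y assume "y \<in> L"
    then have "- (a \<bullet> y) / norm a \<le> - b / norm a"
      using ab(2) by (intro divide_right_mono) auto
    then show "v \<bullet> y \<le> - b / norm a" by (simp add: v_def divide_inverse mult.commute)
  qed
  also have "- b / norm a < - (a \<bullet> x) / norm a"
    using ab \<open>a \<noteq> 0\<close> by (intro divide_strict_right_mono) auto
  also have "\<dots> = v \<bullet> x" by (simp add: v_def divide_inverse mult.commute)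
  finally show ?thesis
    using \<open>a \<noteq> 0\<close> by (intro that[of v]) (auto simp: v_def)
qed

lemma hausdorff_near_not_mem:
  fixes K :: "'a::euclidean_space set"
  assumes K: "K \<in> convex_bodies_o" and x: "x \<notin> K"
  obtains e where "0 < e" "\<And>L. L \<in> convex_bodies_o \<Longrightarrow> hausdorff_distance L K < e \<Longrightarrow> x \<notin> L"
proof -
  obtain v where v: "v \<in> sphere 0 1" "support_function K v < v \<bullet> x"
    using separating_unit_vector[OF K x] by blast
  show ?thesis
  proof (rule that[of "v \<bullet> x - support_function K v"])
    fix L assume L: "L \<in> convex_bodies_o" "hausdorff_distance L K < v \<bullet> x - support_function K v"
    then show "x \<notin> L"
      using support_function_diff_le_hausdorff_distance[OF K L(1) v(1)]
        inner_le_support_function[OF L(1), of x v] by auto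
  qed (use v in simp)
qed

lemma hausdorff_near_cball_mem:
  fixes K :: "'a::euclidean_space set"
  assumes K: "K \<in> convex_bodies_o" and L: "L \<in> convex_bodies_o"
    and x: "cball x e \<subseteq> K" "0 \<le> e" and d: "hausdorff_distance L K < e"
  shows "x \<in> L"
proof (rule ccontr)
  assume "x \<notin> L"
  then obtain v where v: "v \<in> sphere 0 1" "support_function L v < v \<bullet> x"
    using separating_unit_vector[OF L] by blast
  have "x + e *\<^sub>R v \<in> K"
    using x v by (auto simp: dist_norm)
  then have "v \<bullet> (x + e *\<^sub>R v) \<le> support_function K v"
    by (rule inner_le_support_function[OF K])
  moreover have "v \<bullet> v = 1" using v(1) by (simp add: dot_square_norm)
  ultimately have "v \<bullet> x + e \<le> support_function K v" by (simp add: inner_add_right)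
  then show False
    using v(2) d support_function_diff_le_hausdorff_distance[OF K L v(1)] by linarith
qed

lemma hausdorff_near_interior:
  fixes K :: "'a::euclidean_space set"
  assumes K: "K \<in> convex_bodies_o" and x: "x \<in> interior K"
  obtains e where "0 < e" "\<And>L. L \<in> convex_bodies_o \<Longrightarrow> hausdorff_distance L K < e \<Longrightarrow> x \<in> interior L"
proof -
  obtain e where e: "0 < e" "cball x e \<subseteq> K"
    using x mem_interior_cball by blast
  show ?thesis
  proof (rule that[of "e / 2"])
    fix L assume L: "L \<in> convex_bodies_o" "hausdorff_distance L K < e / 2"
    have "y \<in> L" if "y \<in> cball x (e / 2)" for y
    proof (rule hausdorff_near_cball_mem[OF K L(1) _ _ L(2)])
      have "cball y (e / 2) \<subseteq> cball x e"
        using that by (intro subsetI) (auto simp: mem_cball intro: order_trans[OF dist_triangle[of x _ y]])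
      then show "cball y (e / 2) \<subseteq> K" using e by blast
    qed (use e in simp)
    then show "x \<in> interior L"
      using e(1) by (auto simp: mem_interior_cball intro!: exI[of _ "e / 2"])
  qed (use e in simp)
qed

lemma norm_le_hausdorff_distance:
  fixes K :: "'a::euclidean_space set"
  assumes K: "K \<in> convex_bodies_o" and L: "L \<in> convex_bodies_o"
    and b: "\<And>v. v \<in> sphere 0 1 \<Longrightarrow> \<bar>support_function K v\<bar> \<le> b" and y: "y \<in> L" and "0 \<le> b + hausdorff_distance L K"
  shows "norm y \<le> b + hausdorff_distance L K"
proof (cases "y = 0")
  case False
  then have v: "sgn y \<in> sphere 0 1" by (simp add: norm_sgn)
  have "norm y = sgn y \<bullet> y"
    using False by (simp add: sgn_div_norm dot_square_norm power2_eq_square)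
  also have "\<dots> \<le> support_function L (sgn y)"
    by (rule inner_le_support_function[OF L y])
  finally show ?thesis
    using b[OF v] support_function_diff_le_hausdorff_distance[OF K L v] by linarith
qed (use assms in simp)

text \<open>A normal \<open>v\<close> at \<open>x\<close> is characterised by \<open>support_function L v \<le> v \<bullet> x\<close>, and the Hausdorff distance
  bounds the error of the support function at \<open>v i\<close> uniformly in \<open>v i\<close>.\<close>

lemma radial_map_normal_limit:
  fixes K :: "'a::euclidean_space set"
  assumes K: "K \<in> convex_bodies_o" and Ks: "\<And>i. Ks i \<in> convex_bodies_o"
    and hd: "(\<lambda>i. hausdorff_distance (Ks i) K) \<longlonglongrightarrow> 0"
    and r: "(\<lambda>i. radial_function (Ks i) u) \<longlonglongrightarrow> radial_function K u"
    and v: "\<And>i. v i \<in> sphere 0 1" "\<And>i. v i \<in> normal_cone (Ks i) (radial_map (Ks i) u)"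
    and lim: "v \<longlonglongrightarrow> l"
  shows "l \<in> normal_cone K (radial_map K u)"
  unfolding mem_normal_cone_iff
proof
  fix y assume y: "y \<in> K"
  have "v i \<bullet> y \<le> v i \<bullet> radial_map (Ks i) u + hausdorff_distance (Ks i) K" for i
  proof -
    have "support_function (Ks i) (v i) \<le> v i \<bullet> radial_map (Ks i) u"
      using v(2)[of i] by (intro support_function_le[OF Ks]) (simp add: mem_normal_cone_iff)
    then show ?thesis
      using inner_le_support_function[OF K y, of "v i"]
        support_function_diff_le_hausdorff_distance[OF K Ks v(1), of i i] by linarith
  qed
  moreover have "(\<lambda>i. v i \<bullet> y) \<longlonglongrightarrow> l \<bullet> y"
    by (intro tendsto_intros lim)
  moreover have "(\<lambda>i. v i \<bullet> radial_map (Ks i) u + hausdorff_distance (Ks i) K) \<longlonglongrightarrow> l \<bullet> radial_map K u + 0"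
    unfolding radial_map_def by (intro tendsto_intros lim hd r)
  ultimately show "l \<bullet> y \<le> l \<bullet> radial_map K u"
    using LIMSEQ_le[of "\<lambda>i. v i \<bullet> y"] by fastforce
qed

context
  fixes K :: "'a::euclidean_space set" and Ks :: "nat \<Rightarrow> 'a set"
  assumes K: "K \<in> convex_bodies_o" and Ks: "\<And>i. Ks i \<in> convex_bodies_o"
    and hd: "(\<lambda>i. hausdorff_distance (Ks i) K) \<longlonglongrightarrow> 0"
begin

lemma eventually_near:
  assumes "0 < e" "\<And>L. L \<in> convex_bodies_o \<Longrightarrow> hausdorff_distance L K < e \<Longrightarrow> P L"
  shows "\<forall>\<^sub>F i in sequentially. P (Ks i)"
  using order_tendstoD(2)[OF hd \<open>0 < e\<close>] by eventually_elim (use assms Ks in blast)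

lemma eventually_interior:
  assumes "x \<in> interior K"
  shows "\<forall>\<^sub>F i in sequentially. x \<in> interior (Ks i)"
proof -
  obtain e where "0 < e" "\<And>L. L \<in> convex_bodies_o \<Longrightarrow> hausdorff_distance L K < e \<Longrightarrow> x \<in> interior L"
    using hausdorff_near_interior[OF K assms] by blast
  then show ?thesis by (rule eventually_near)
qed

lemma eventually_not_mem:
  assumes "x \<notin> K"
  shows "\<forall>\<^sub>F i in sequentially. x \<notin> Ks i"
proof -
  obtain e where "0 < e" "\<And>L. L \<in> convex_bodies_o \<Longrightarrow> hausdorff_distance L K < e \<Longrightarrow> x \<notin> L"
    using hausdorff_near_not_mem[OF K assms] by blast
  then show ?thesis by (rule eventually_near)
qed

lemma bounded_convergent_bodies:
  obtains R where "\<And>i y. y \<in> Ks i \<Longrightarrow> norm y \<le> R"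
proof -
  obtain b where b: "\<And>v. v \<in> sphere 0 1 \<Longrightarrow> \<bar>support_function K v\<bar> \<le> b"
    using support_function_bounded[OF K] by blast
  obtain D where D: "\<And>i. \<bar>hausdorff_distance (Ks i) K\<bar> \<le> D"
    using Bseq_eq_bounded convergent_imp_Bseq[OF convergentI[OF hd]] by (auto simp: Bseq_def)
  obtain e :: 'a where e: "e \<in> sphere 0 1"
    using vector_choose_size[of 1] by auto
  have "norm y \<le> \<bar>b\<bar> + D" if "y \<in> Ks i" for i y
  proof -
    have "0 \<le> hausdorff_distance (Ks i) K"
      using support_function_diff_le_hausdorff_distance[OF K Ks e, of i] by linarith
    moreover have "0 \<le> b" using b[OF e] by linarith
    ultimately show ?thesis
      using norm_le_hausdorff_distance[OF K Ks b that] D[of i] by fastforce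
  qed
  then show ?thesis by (rule that)
qed

lemma radial_function_tendsto:
  assumes u: "u \<in> sphere 0 1"
    and cond: "radial_function K u = 0 \<or> (\<exists>t>0. t *\<^sub>R u \<in> interior K)"
  shows "(\<lambda>i. radial_function (Ks i) u) \<longlonglongrightarrow> radial_function K u"
proof (rule order_tendstoI)
  fix a assume a: "a > radial_function K u"
  then have "a *\<^sub>R u \<notin> K"
    using le_radial_function[OF K u, of a] radial_function_nonneg[OF K u] by auto
  then have "\<forall>\<^sub>F i in sequentially. a *\<^sub>R u \<notin> Ks i" by (rule eventually_not_mem)
  then show "\<forall>\<^sub>F i in sequentially. radial_function (Ks i) u < a"
  proof eventually_elim
    case (elim i)
    then show ?case
      using scaleR_mem_if_le_radial_function[OF Ks u, of a i] a radial_function_nonneg[OF K u] by force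
  qed
next
  fix a assume a: "a < radial_function K u"
  show "\<forall>\<^sub>F i in sequentially. a < radial_function (Ks i) u"
  proof (cases "a < 0")
    case True
    then show ?thesis
      using radial_function_nonneg[OF Ks u] by (intro always_eventually) (auto intro: less_le_trans)
  next
    case False
    define r where "r = radial_function K u"
    obtain t where t: "0 < t" "t *\<^sub>R u \<in> interior K"
      using cond a False by auto
    have "t \<le> r"
      using le_radial_function[OF K u, of t] t interior_subset unfolding r_def by force
    moreover have "t \<noteq> r"
      using radial_map_in_frontier[OF K u] t(2) by (auto simp: r_def radial_map_def frontier_def)
    ultimately have "t < r" by simp
    define b where "b = (max a t + r) / 2"
    have b: "a < b" "t < b" "b < r" "0 < b"
      using \<open>t < r\<close> a t(1) by (auto simp: b_def r_def)
    define e where "e = (r - b) / (r - t)"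
    have e: "0 < e" "e \<le> 1" "e * (r - t) = r - b"
      using b \<open>t < r\<close> by (auto simp: e_def field_simps)
    have "r *\<^sub>R u - e *\<^sub>R (r *\<^sub>R u - t *\<^sub>R u) \<in> interior K"
      using radial_map_mem[OF K u] t(2) convex_bodies_oD[OF K] e
      by (intro mem_interior_convex_shrink) (auto simp: r_def radial_map_def)
    moreover have "r *\<^sub>R u - e *\<^sub>R (r *\<^sub>R u - t *\<^sub>R u) = (r - e * (r - t)) *\<^sub>R u"
      by (simp add: algebra_simps)
    ultimately have "b *\<^sub>R u \<in> interior K"
      using e(3) by simp
    then have "\<forall>\<^sub>F i in sequentially. b *\<^sub>R u \<in> interior (Ks i)" by (rule eventually_interior)
    then show ?thesis
    proof eventually_elim
      case (elim i)
      then have "b *\<^sub>R u \<in> Ks i" using interior_subset by blast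
      then have "b \<le> radial_function (Ks i) u"
        using b by (intro le_radial_function[OF Ks u]) auto
      with b show ?case by simp
    qed
  qed
qed

lemma unit_normals_tendsto:
  assumes r: "(\<lambda>i. radial_function (Ks i) u) \<longlonglongrightarrow> radial_function K u"
    and v: "\<forall>\<^sub>F i in sequentially. v i \<in> sphere 0 1 \<and> v i \<in> normal_cone (Ks i) (radial_map (Ks i) u)"
    and uniq: "\<And>w. w \<in> sphere 0 1 \<Longrightarrow> w \<in> normal_cone K (radial_map K u) \<Longrightarrow> w = l"
  shows "v \<longlonglongrightarrow> l"
proof (rule ccontr)
  assume "\<not> v \<longlonglongrightarrow> l"
  then obtain e where e: "0 < e" "\<not> (\<forall>\<^sub>F i in sequentially. dist (v i) l < e)"
    by (auto simp: tendsto_iff)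
  define S where "S = {i. (v i \<in> sphere 0 1 \<and> v i \<in> normal_cone (Ks i) (radial_map (Ks i) u)) \<and> \<not> dist (v i) l < e}"
  have "\<exists>\<^sub>F i in sequentially. \<not> dist (v i) l < e"
    using e(2) by (simp add: not_eventually)
  then have "\<exists>\<^sub>F i in sequentially. i \<in> S"
    using v unfolding S_def mem_Collect_eq by (rule frequently_eventually_conj)
  then have "infinite S"
    by (simp add: frequently_cofinite cofinite_eq_sequentially[symmetric])
  then obtain s :: "nat \<Rightarrow> nat" where s: "strict_mono s" "\<And>n. s n \<in> S"
    using infinite_enumerate by blast
  have "\<forall>n. (v \<circ> s) n \<in> sphere 0 1"
    using s(2) by (auto simp: S_def)
  then obtain w q where w: "w \<in> sphere 0 1" "strict_mono q" "((v \<circ> s) \<circ> q) \<longlonglongrightarrow> w"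
    using compact_sphere[of 0 1, unfolded compact_def] by metis
  have sq: "strict_mono (s \<circ> q)" using s w by (simp add: strict_mono_o)
  have "w \<in> normal_cone K (radial_map K u)"
  proof (rule radial_map_normal_limit[where Ks = "Ks \<circ> (s \<circ> q)", OF K _ _ _ _ _ w(3)])
    show "(\<lambda>i. hausdorff_distance ((Ks \<circ> (s \<circ> q)) i) K) \<longlonglongrightarrow> 0"
      using LIMSEQ_subseq_LIMSEQ[OF hd sq] by (simp add: o_def)
    show "(\<lambda>i. radial_function ((Ks \<circ> (s \<circ> q)) i) u) \<longlonglongrightarrow> radial_function K u"
      using LIMSEQ_subseq_LIMSEQ[OF r sq] by (simp add: o_def)
  qed (use Ks s(2) in \<open>auto simp: S_def\<close>)
  with uniq w(1) have "w = l" by blast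
  then have "\<forall>\<^sub>F i in sequentially. dist ((v \<circ> s \<circ> q) i) l < e"
    using w(3) e(1) by (auto simp: tendsto_iff)
  moreover have "\<not> dist ((v \<circ> s \<circ> q) i) l < e" for i
    using s(2) by (auto simp: S_def)
  ultimately show False by simp
qed

end

section \<open>The three properties of the dual curvature measure\<close>

lemma finite_signed_measure_dual_curvature_measure:
  fixes K :: "'a::euclidean_space set"
  assumes K: "K \<in> convex_bodies_o"
    and null: "hausdorff_outer_measure (DIM('a) - 1) (fat_fibre_directions K) = 0"
    and int: "\<And>E. E \<in> sets sphere_borel \<Longrightarrow> dual_curvature_integrable G K E"
  shows "finite_signed_measure sphere_borel (dual_curvature_measure G K)"
proof -
  obtain e :: 'a where e: "e \<in> sphere 0 1"
    using vector_choose_size[of 1] by auto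
  obtain M1 M2 where M: "finite_measure M1" "finite_measure M2"
    "sets M1 = sets sphere_borel" "sets M2 = sets sphere_borel"
    "\<And>E. E \<in> sets sphere_borel \<Longrightarrow> dual_curvature_measure G K E = measure M1 E - measure M2 E"
    using dual_curvature_measure_decomposition[OF K null int e] by metis
  have "(\<lambda>i. dual_curvature_measure G K (A i)) sums dual_curvature_measure G K (\<Union>i. A i)"
    if A: "range A \<subseteq> sets sphere_borel" "disjoint_family A" for A
  proof -
    have "A i \<in> sets sphere_borel" for i using A(1) by blast
    moreover have "(\<Union>i. A i) \<in> sets sphere_borel" using A(1) by blast
    moreover have "(\<lambda>i. measure M1 (A i) - measure M2 (A i)) sums (measure M1 (\<Union>i. A i) - measure M2 (\<Union>i. A i))"
      using A M by (intro sums_diff finite_measure.finite_measure_UNION) auto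
    ultimately show ?thesis by (simp add: M(5))
  qed
  then show ?thesis
    using M(5)[of "{}"] by (simp add: finite_signed_measure_def)
qed

text \<open>The domain of integration is the radial projection of a part of \<open>reverse_spherical_image K E\<close> that
  avoids the origin, so it is a null set together with the latter.\<close>

lemma dual_curvature_measure_eq_0:
  fixes K :: "'a::euclidean_space set"
  assumes K: "K \<in> convex_bodies_o" and zero: "surface_area_measure K E = 0"
  shows "dual_curvature_measure G K E = 0"
proof -
  let ?H = "hausdorff_measure (DIM('a) - 1) :: 'a measure"
  define D where "D = dual_curvature_domain K E"
  have "hausdorff_outer_measure (DIM('a) - 1) (reverse_spherical_image K E - {0}) = 0"
    by (rule hausdorff_null_subset[OF Diff_subset zero[unfolded surface_area_measure_def]])
  then have "hausdorff_outer_measure (DIM('a) - 1) (sgn ` (reverse_spherical_image K E - {0})) = 0"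
    by (rule hausdorff_null_sgn_image) simp
  moreover have "D \<subseteq> sgn ` (reverse_spherical_image K E - {0})"
  proof
    fix u assume u: "u \<in> D"
    then obtain v where v: "u \<in> sphere 0 1" "v \<in> E" "v \<in> normal_cone K (radial_map K u)" "0 < v \<bullet> radial_map K u"
      by (auto simp: D_def mem_dual_curvature_domain_iff[OF K])
    then have "radial_map K u \<in> reverse_spherical_image K E - {0}"
      using radial_map_in_frontier[OF K v(1)] by (auto simp: reverse_spherical_image_def)
    moreover have "0 < radial_function K u"
      using v(4) radial_function_nonneg[OF K v(1)] by (auto simp: radial_map_def zero_less_mult_iff)
    then have "sgn (radial_map K u) = u"
      using v(1) by (simp add: radial_map_def sgn_scaleR sgn_div_norm)
    ultimately show "u \<in> sgn ` (reverse_spherical_image K E - {0})" by force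
  qed
  ultimately have "D \<in> null_sets ?H"
    by (intro hausdorff_null_in_null_sets) (rule hausdorff_null_subset)
  then have "AE u in ?H. u \<notin> D" by (rule AE_not_in)
  then have "AE u in ?H. indicator D u *\<^sub>R dual_curvature_integrand G K u = 0"
    by eventually_elim simp
  then have "(\<integral>u. indicator D u *\<^sub>R dual_curvature_integrand G K u \<partial>?H) = 0"
    by (rule integral_eq_zero_AE)
  then show ?thesis
    by (simp add: dual_curvature_measure_def set_lebesgue_integral_def D_def)
qed

lemma signed_integral_dual_curvature_measure:
  fixes K :: "'a::euclidean_space set"
  assumes K: "K \<in> convex_bodies_o"
    and null: "hausdorff_outer_measure (DIM('a) - 1) (fat_fibre_directions K) = 0"
    and int: "\<And>E. E \<in> sets sphere_borel \<Longrightarrow> dual_curvature_integrable G K E"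
    and e: "e \<in> sphere 0 1"
    and f: "f \<in> borel_measurable sphere_borel" and B: "\<And>v. v \<in> sphere 0 1 \<Longrightarrow> \<bar>f v\<bar> \<le> B"
  shows "signed_integral sphere_borel (dual_curvature_measure G K) f = 1 / real DIM('a) *
    (\<integral>u. carrier_density G K u * f (carrier_gauss_map G K e u) \<partial>hausdorff_measure (DIM('a) - 1))"
proof (rule dual_curvature_measure_decomposition[OF K null int e])
  fix M1 M2 :: "'a measure" assume M: "finite_measure M1" "finite_measure M2"
    "sets M1 = sets sphere_borel" "sets M2 = sets sphere_borel"
    "\<And>E. E \<in> sets sphere_borel \<Longrightarrow> dual_curvature_measure G K E = measure M1 E - measure M2 E"
    and diff: "\<And>f B. f \<in> borel_measurable sphere_borel \<Longrightarrow> (\<And>v. v \<in> sphere 0 1 \<Longrightarrow> \<bar>f v\<bar> \<le> B) \<Longrightarrow>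
       integral\<^sup>L M1 f - integral\<^sup>L M2 f = 1 / real DIM('a) *
         (\<integral>u. carrier_density G K u * f (carrier_gauss_map G K e u) \<partial>hausdorff_measure (DIM('a) - 1))"
  have "signed_integral sphere_borel (dual_curvature_measure G K) f = integral\<^sup>L M1 f - integral\<^sup>L M2 f"
    by (rule signed_integral_diff[OF M(1-5) f]) (use B in auto)
  with diff[OF f B] show ?thesis by simp
qed

lemma continuous_on_sphere_bounded:
  fixes f :: "'a::euclidean_space \<Rightarrow> real"
  assumes "continuous_on (sphere 0 1) f"
  obtains b where "\<And>v. v \<in> sphere 0 1 \<Longrightarrow> \<bar>f v\<bar> \<le> b"
proof -
  have "bounded (f ` sphere 0 1)"
    by (intro compact_imp_bounded compact_continuous_image assms compact_sphere)
  then obtain b where "\<forall>x\<in>f ` sphere 0 1. norm x \<le> b"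
    unfolding bounded_iff by blast
  then show ?thesis by (intro that[of b]) simp
qed

text \<open>Where \<open>radial_function K u\<close> vanishes, the integrands tend to 0. Elsewhere the ray meets the interior
  of \<open>K\<close>, and the unit normals of \<open>Ks i\<close> can only accumulate at the unique normal of \<open>K\<close>.\<close>

lemma carrier_density_tendsto:
  fixes K :: "'a::euclidean_space set" and f :: "'a \<Rightarrow> real"
  assumes K: "K \<in> convex_bodies_o" and Ks: "\<And>i. Ks i \<in> convex_bodies_o"
    and hd: "(\<lambda>i. hausdorff_distance (Ks i) K) \<longlonglongrightarrow> 0"
    and cont: "continuous_on ({0..} \<times> sphere 0 1) (\<lambda>(t, u). if t = 0 then 0 else t * partial_t G t u)"
    and f: "continuous_on (sphere 0 1) f" and e: "e \<in> sphere 0 1"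
    and u: "u \<notin> fat_fibre_directions K" "\<And>i. u \<notin> fat_fibre_directions (Ks i)"
  shows "(\<lambda>i. carrier_density G (Ks i) u * f (carrier_gauss_map G (Ks i) e u))
     \<longlonglongrightarrow> carrier_density G K u * f (carrier_gauss_map G K e u)"
proof (cases "u \<in> sphere 0 1")
  case False
  then have "u \<notin> curvature_carrier G L" if "L \<in> convex_bodies_o" for L
    using that by (auto simp: curvature_carrier_def mem_dual_curvature_domain_iff)
  then have "carrier_density G L u = 0" if "L \<in> convex_bodies_o" for L
    using that by (simp add: carrier_density_def)
  with K Ks show ?thesis by simp
next
  case True
  define g where "g L = dual_curvature_integrand G L u" for L
  define F where "F = (\<lambda>(t, u). if t = 0 then 0 else t * partial_t G t u)"
  have gF: "g L = F (radial_function L u, u)" for L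
    by (simp add: g_def dual_curvature_integrand_def F_def)
  obtain b where b: "\<And>v. v \<in> sphere 0 1 \<Longrightarrow> \<bar>f v\<bar> \<le> b"
    using continuous_on_sphere_bounded[OF f] by blast
  have gauss: "carrier_gauss_map G L e u \<in> sphere 0 1" if "L \<in> convex_bodies_o" for L
    using radial_gauss_map(1)[OF that] e by (auto simp: carrier_gauss_map_def curvature_carrier_def)
  have cases: "radial_function K u = 0 \<or> (\<exists>t>0. t *\<^sub>R u \<in> interior K)"
  proof (cases "radial_function K u = 0")
    case False
    then have "0 < radial_function K u"
      using radial_function_nonneg[OF K True] by simp
    then obtain t where "0 < t" "t *\<^sub>R u \<in> interior K"
      using ray_meets_interior_off_fat_fibres[OF K True u(1)] by blast
    then show ?thesis by blast
  qed simp
  have r: "(\<lambda>i. radial_function (Ks i) u) \<longlonglongrightarrow> radial_function K u"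
    by (rule radial_function_tendsto[OF K Ks hd True cases])
  have "((\<lambda>i. F (radial_function (Ks i) u, u)) \<longlongrightarrow> F (radial_function K u, u)) sequentially"
    by (rule continuous_on_tendsto_compose[OF cont[folded F_def]])
       (use radial_function_nonneg[OF K True] radial_function_nonneg[OF Ks True] True in
         \<open>auto intro!: tendsto_Pair r always_eventually\<close>)
  then have g: "(\<lambda>i. g (Ks i)) \<longlonglongrightarrow> g K" by (simp add: gF)
  show ?thesis
  proof (cases "g K = 0")
    case True
    have "(\<lambda>i. carrier_density G (Ks i) u * f (carrier_gauss_map G (Ks i) e u)) \<longlonglongrightarrow> 0"
    proof (rule Lim_null_comparison)
      have "norm (carrier_density G (Ks i) u * f (carrier_gauss_map G (Ks i) e u)) \<le> \<bar>g (Ks i)\<bar> * b" for i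
        unfolding real_norm_def abs_mult
        using b[OF gauss[OF Ks]] by (intro mult_mono) (auto simp: carrier_density_def g_def indicator_def)
      then show "\<forall>\<^sub>F i in sequentially. norm (carrier_density G (Ks i) u * f (carrier_gauss_map G (Ks i) e u))
          \<le> \<bar>g (Ks i)\<bar> * b" by simp
      show "(\<lambda>i. \<bar>g (Ks i)\<bar> * b) \<longlonglongrightarrow> 0"
        using tendsto_mult[OF tendsto_rabs[OF g] tendsto_const[of b]] True by simp
    qed
    moreover have "carrier_density G K u = 0"
      using True by (simp add: carrier_density_def g_def)
    ultimately show ?thesis by simp
  next
    case False
    then have "radial_function K u \<noteq> 0"
      by (auto simp: gF F_def)
    with cases obtain t where t: "0 < t" "t *\<^sub>R u \<in> interior K" by blast
    have carrier: "u \<in> curvature_carrier G L"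
      if L: "L \<in> convex_bodies_o" "t *\<^sub>R u \<in> interior L" "g L \<noteq> 0" "u \<notin> fat_fibre_directions L" for L
    proof -
      have fr: "radial_map L u \<in> L" "radial_map L u \<notin> interior L"
        using radial_map_in_frontier[OF L(1) \<open>u \<in> sphere 0 1\<close>] radial_map_mem[OF L(1) \<open>u \<in> sphere 0 1\<close>]
        by (auto simp: frontier_def)
      obtain v where v: "v \<in> sphere 0 1" "v \<in> normal_cone L (radial_map L u)"
        using unit_normal_exists[OF convex_bodies_oD(2,4)[OF L(1)] fr] by blast
      have "0 < v \<bullet> radial_map L u"
        by (rule normal_inner_radial_map_pos[OF L(1) \<open>u \<in> sphere 0 1\<close> t(1) L(2) v])
      with v L show ?thesis
        using \<open>u \<in> sphere 0 1\<close>
        by (auto simp: curvature_carrier_def mem_dual_curvature_domain_iff[OF L(1)] g_def)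
    qed
    have uK: "u \<in> curvature_carrier G K" by (rule carrier[OF K t(2) False u(1)])
    have "\<forall>\<^sub>F i in sequentially. g (Ks i) \<noteq> 0"
      by (rule tendsto_imp_eventually_ne[OF g False])
    with eventually_interior[OF K Ks hd t(2)]
    have ev: "\<forall>\<^sub>F i in sequentially. u \<in> curvature_carrier G (Ks i)"
      by eventually_elim (rule carrier[OF Ks _ _ u(2)])
    have "(\<lambda>i. carrier_gauss_map G (Ks i) e u) \<longlonglongrightarrow> carrier_gauss_map G K e u"
    proof (rule unit_normals_tendsto[OF K Ks hd r])
      show "\<forall>\<^sub>F i in sequentially. carrier_gauss_map G (Ks i) e u \<in> sphere 0 1 \<and>
          carrier_gauss_map G (Ks i) e u \<in> normal_cone (Ks i) (radial_map (Ks i) u)"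
        using ev
      proof eventually_elim
        case (elim i)
        then show ?case
          using radial_gauss_map[OF Ks, of u i] by (auto simp: carrier_gauss_map_def curvature_carrier_def)
      qed
      fix w :: 'a assume w: "w \<in> sphere 0 1" "w \<in> normal_cone K (radial_map K u)"
      have "u \<in> dual_curvature_domain K (sphere 0 1)" using uK by (simp add: curvature_carrier_def)
      from normal_unique_off_fat_fibres[OF K \<open>u \<in> sphere 0 1\<close> u(1) w _ radial_gauss_map[OF K this]]
        normal_inner_radial_map_pos[OF K \<open>u \<in> sphere 0 1\<close> t w]
      show "w = carrier_gauss_map G K e u"
        using uK by (simp add: carrier_gauss_map_def)
    qed
    then have "(\<lambda>i. f (carrier_gauss_map G (Ks i) e u)) \<longlonglongrightarrow> f (carrier_gauss_map G K e u)"
      by (rule continuous_on_tendsto_compose[OF f]) (use gauss K Ks in auto)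
    with g have "(\<lambda>i. g (Ks i) * f (carrier_gauss_map G (Ks i) e u)) \<longlonglongrightarrow> g K * f (carrier_gauss_map G K e u)"
      by (rule tendsto_mult)
    moreover have "\<forall>\<^sub>F i in sequentially. g (Ks i) * f (carrier_gauss_map G (Ks i) e u)
        = carrier_density G (Ks i) u * f (carrier_gauss_map G (Ks i) e u)"
      using ev by eventually_elim (simp add: carrier_density_def g_def)
    ultimately have "(\<lambda>i. carrier_density G (Ks i) u * f (carrier_gauss_map G (Ks i) e u))
        \<longlonglongrightarrow> g K * f (carrier_gauss_map G K e u)"
      by (rule Lim_transform_eventually)
    then show ?thesis
      using uK by (simp add: carrier_density_def g_def)
  qed
qed

text \<open>The dominating function is a constant on the union of the carriers, a measurable set of finite
  measure; the densities are uniformly bounded because the bodies stay in a fixed ball.\<close>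

lemma weakly_convergent_dual_curvature_measure:
  fixes K :: "'a::euclidean_space set"
  assumes K: "K \<in> convex_bodies_o" and Ks: "\<And>i. Ks i \<in> convex_bodies_o"
    and hd: "(\<lambda>i. hausdorff_distance (Ks i) K) \<longlonglongrightarrow> 0"
    and cont: "continuous_on ({0..} \<times> sphere 0 1) (\<lambda>(t, u). if t = 0 then 0 else t * partial_t G t u)"
    and null: "\<And>L :: 'a set. L \<in> convex_bodies_o \<Longrightarrow> hausdorff_outer_measure (DIM('a) - 1) (fat_fibre_directions L) = 0"
    and fin: "hausdorff_outer_measure (DIM('a) - 1) (sphere (0::'a) 1) < top"
    and int: "\<And>L E. L \<in> convex_bodies_o \<Longrightarrow> E \<in> sets sphere_borel \<Longrightarrow> dual_curvature_integrable G L E"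
  shows "weakly_convergent_on_sphere (\<lambda>i. dual_curvature_measure G (Ks i)) (dual_curvature_measure G K)"
  unfolding weakly_convergent_on_sphere_def
proof (intro allI impI)
  fix f :: "'a \<Rightarrow> real" assume f: "continuous_on (sphere 0 1) f"
  define H where "H = (hausdorff_measure (DIM('a) - 1) :: 'a measure)"
  obtain e :: 'a where e: "e \<in> sphere 0 1"
    using vector_choose_size[of 1] by auto
  have fm[measurable]: "f \<in> borel_measurable sphere_borel"
    unfolding sphere_borel_def by (rule borel_measurable_continuous_on_restrict[OF f])
  obtain b where b: "\<And>v. v \<in> sphere 0 1 \<Longrightarrow> \<bar>f v\<bar> \<le> b"
    using continuous_on_sphere_bounded[OF f] by blast
  define h where "h L = (\<lambda>u. carrier_density G L u * f (carrier_gauss_map G L e u))" for L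
  have si: "signed_integral sphere_borel (dual_curvature_measure G L) f = 1 / real DIM('a) * integral\<^sup>L H (h L)"
    if "L \<in> convex_bodies_o" for L
    using signed_integral_dual_curvature_measure[OF that null[OF that] int[OF that] e fm b] that by (simp add: h_def H_def)
  have hm[measurable]: "h L \<in> borel_measurable H" if "L \<in> convex_bodies_o" for L
  proof -
    have "carrier_gauss_map G L e \<in> measurable H sphere_borel" "carrier_density G L \<in> borel_measurable H"
      using measurable_carrier_gauss_map[OF that null[OF that] int[OF that] e] integrable_carrier_density[OF that null[OF that] int[OF that] e] that
      by (auto simp: H_def)
    then show ?thesis unfolding h_def by measurable
  qed
  define V where "V = (\<Union>i. curvature_carrier G (Ks i))"
  have V: "V \<in> sets H"
    unfolding V_def using curvature_carrier_sets[OF Ks null[OF Ks] int[OF Ks] e] Ks by (auto simp: H_def)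
  have "V \<subseteq> sphere 0 1"
    using Ks by (auto simp: V_def curvature_carrier_def mem_dual_curvature_domain_iff)
  then have "hausdorff_outer_measure (DIM('a) - 1) V < top"
    using fin by (blast intro: order_le_less_trans[OF hausdorff_outer_measure_mono])
  then have Vfin: "emeasure H V < top"
    using V by (simp add: H_def emeasure_hausdorff_measure)
  obtain R where R: "\<And>i y. y \<in> Ks i \<Longrightarrow> norm y \<le> R"
    using bounded_convergent_bodies[OF K Ks hd] by metis
  define F where "F = (\<lambda>(t, u::'a). if t = 0 then 0 else t * partial_t G t u)"
  have "compact ({0..R} \<times> sphere (0::'a) 1)" by (intro compact_Times) auto
  moreover have "continuous_on ({0..R} \<times> sphere 0 1) F"
    using cont unfolding F_def by (rule continuous_on_subset) auto
  ultimately have "bounded (F ` ({0..R} \<times> sphere 0 1))"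
    by (intro compact_imp_bounded compact_continuous_image)
  then obtain m where "\<forall>x\<in>F ` ({0..R} \<times> sphere 0 1). norm x \<le> m"
    unfolding bounded_iff by blast
  then have m: "\<bar>F (t, u)\<bar> \<le> m" if "t \<in> {0..R}" "u \<in> sphere 0 1" for t u
    using that by simp
  have dens: "\<bar>h (Ks i) u\<bar> \<le> m * b * indicator V u" for i u
  proof (cases "u \<in> curvature_carrier G (Ks i)")
    case True
    then have "u \<in> V" by (auto simp: V_def)
    then have u: "u \<in> sphere 0 1" "u \<in> V"
      using \<open>V \<subseteq> _\<close> by blast+
    have "norm (radial_map (Ks i) u) \<le> R" by (rule R[OF radial_map_mem[OF Ks u(1)]])
    then have "radial_function (Ks i) u \<in> {0..R}"
      using u(1) radial_function_nonneg[OF Ks u(1), of i] by (simp add: radial_map_def)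
    then have "\<bar>F (radial_function (Ks i) u, u)\<bar> \<le> m" by (rule m[OF _ u(1)])
    then have "\<bar>carrier_density G (Ks i) u\<bar> \<le> m"
      using True by (auto simp: carrier_density_def dual_curvature_integrand_def F_def split: if_splits)
    moreover have "\<bar>f (carrier_gauss_map G (Ks i) e u)\<bar> \<le> b"
      using True radial_gauss_map(1)[OF Ks, of u i]
      by (intro b) (auto simp: carrier_gauss_map_def curvature_carrier_def)
    ultimately have "\<bar>h (Ks i) u\<bar> \<le> m * b"
      unfolding h_def abs_mult by (intro mult_mono) auto
    then show ?thesis using u(2) by simp
  next
    case False
    have "0 \<le> m * b"
    proof (rule mult_nonneg_nonneg)
      have "0 \<le> R" using R[OF convex_bodies_oD(3)[OF Ks]] by simp
      then show "0 \<le> m" using m[of 0 e] e by force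
      show "0 \<le> b" using b[OF e] by linarith
    qed
    with False show ?thesis by (simp add: h_def carrier_density_def)
  qed
  have "(\<lambda>i. integral\<^sup>L H (h (Ks i))) \<longlonglongrightarrow> integral\<^sup>L H (h K)"
  proof (rule integral_dominated_convergence[where w = "\<lambda>u. m * b * indicator V u"])
    show "integrable H (\<lambda>u. m * b * indicator V u)"
      using V Vfin by (intro integrable_mult_right integrable_real_indicator) auto
    have "AE u in H. \<forall>i. u \<notin> fat_fibre_directions (Ks i)"
      unfolding AE_all_countable H_def
      by (intro allI AE_not_in hausdorff_null_in_null_sets null Ks)
    moreover have "AE u in H. u \<notin> fat_fibre_directions K"
      unfolding H_def using null[OF K] by (intro AE_not_in hausdorff_null_in_null_sets)
    ultimately show "AE u in H. (\<lambda>i. h (Ks i) u) \<longlonglongrightarrow> h K u"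
      unfolding h_def by eventually_elim (rule carrier_density_tendsto[OF K Ks hd cont f e], auto)
  qed (use hm K Ks dens in auto)
  then show "(\<lambda>i. signed_integral sphere_borel (dual_curvature_measure G (Ks i)) f)
      \<longlonglongrightarrow> signed_integral sphere_borel (dual_curvature_measure G K) f"
    unfolding si[OF K] si[OF Ks] by (intro tendsto_mult tendsto_const)
qed

theorem proposition5p2:
  fixes G :: "real \<Rightarrow> real ^ 'n \<Rightarrow> real"
    and K :: "(real ^ 'n) set"
  assumes dim: "2 \<le> CARD('n)"
    and G_nonneg: "\<And>t u. 0 \<le> t \<Longrightarrow> u \<in> sphere 0 1 \<Longrightarrow> 0 \<le> G t u"
    and G_diff: "\<And>t u. 0 < t \<Longrightarrow> u \<in> sphere 0 1 \<Longrightarrow> (\<lambda>s. G s u) differentiable (at t)"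
    and G_int: "\<And>L E. L \<in> convex_bodies_o \<Longrightarrow> E \<in> sets sphere_borel \<Longrightarrow> dual_curvature_integrable G L E"
    and K: "K \<in> convex_bodies_o"
  shows "finite_signed_measure sphere_borel (dual_curvature_measure G K)
    \<and> (continuous_on ({0..} \<times> sphere 0 1)
          (\<lambda>(t, u). extend_to_zero (\<lambda>t u. t powi (1 - int CARD('n)) * partial_t G t u) t u)
        \<longrightarrow> signed_absolutely_continuous sphere_borel
              (dual_curvature_measure G K) (surface_area_measure K))
    \<and> (continuous_on ({0..} \<times> sphere 0 1)
          (\<lambda>(t, u). if t = 0 then 0 else t * partial_t G t u)
        \<longrightarrow> (\<forall>Ks :: nat \<Rightarrow> (real ^ 'n) set.
              (\<forall>i. Ks i \<in> convex_bodies_o) \<longrightarrow>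
              (\<lambda>i. hausdorff_distance (Ks i) K) \<longlonglongrightarrow> 0 \<longrightarrow>
              weakly_convergent_on_sphere (\<lambda>i. dual_curvature_measure G (Ks i))
                (dual_curvature_measure G K)))"
proof -
  have null: "hausdorff_outer_measure (DIM(real ^ 'n) - 1) (fat_fibre_directions L) = 0"
    if "L \<in> convex_bodies_o" for L :: "(real ^ 'n) set"
    using hausdorff_null_fat_fibre_directions[of L] convex_bodies_oD[OF that] by simp
  have fin: "hausdorff_outer_measure (DIM(real ^ 'n) - 1) (sphere (0 :: real ^ 'n) 1) < top"
    using hausdorff_sphere_finite by simp
  show ?thesis
  proof (intro conjI impI allI)
    show "finite_signed_measure sphere_borel (dual_curvature_measure G K)"
      by (rule finite_signed_measure_dual_curvature_measure[OF K null[OF K] G_int[OF K]])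
    show "signed_absolutely_continuous sphere_borel (dual_curvature_measure G K) (surface_area_measure K)"
      unfolding signed_absolutely_continuous_def using dual_curvature_measure_eq_0[OF K] by blast
    fix Ks :: "nat \<Rightarrow> (real ^ 'n) set"
    assume cont: "continuous_on ({0..} \<times> sphere 0 1) (\<lambda>(t, u). if t = 0 then 0 else t * partial_t G t u)"
      and Ks: "\<forall>i. Ks i \<in> convex_bodies_o" and hd: "(\<lambda>i. hausdorff_distance (Ks i) K) \<longlonglongrightarrow> 0"
    show "weakly_convergent_on_sphere (\<lambda>i. dual_curvature_measure G (Ks i)) (dual_curvature_measure G K)"
      by (rule weakly_convergent_dual_curvature_measure[OF K Ks[rule_format] hd cont null fin G_int])
  qed
qed

end
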